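(* Let $G$ be a countable group. Suppose that for every finite set $A$ with at least two elements the set of isolated subshifts is dense in the space $\mathcal{S}_G(A)$ of all subshifts of $A^G$. Then $G$ has the strong topological Rokhlin property.
   Context: $\mathcal{C}$ is the Cantor space and $\mathrm{Homeo}(\mathcal{C})$ is the topological group of its self-homeomorphisms with the uniform topology. $\mathrm{Act}_G(\mathcal{C})$ is the Polish space of all continuous actions of $G$ on $\mathcal{C}$, identified with the set of homomorphisms $G\to\mathrm{Homeo}(\mathcal{C})$, a closed subset of $\mathrm{Homeo}(\mathcal{C})^G$ with the product topology. $G$ has the strong topological Rokhlin property if there is $\alpha\in\mathrm{Act}_G(\mathcal{C})$ whose conjugacy class $\{\phi\alpha\phi^{-1}:\phi\in\mathrm{Homeo}(\mathcal{C})\}$, where $(\phi\alpha\phi^{-1})(g)=\phi\alpha(g)\phi^{-1}$, is comeager in $\mathrm{Act}_G(\mathcal{C})$. For a finite set $A$, $G$ acts on $A^G$ (product topology) by $(gx)(h)=x(g^{-1}h)$. A subshift of $A^G$ is a non-empty closed $G$-invariant subset. $\mathcal{S}_G(A)$ is the compact space of all subshifts of $A^G$ with the Vietoris topology (equivalently the Hausdorff metric topology). A subshift is isolated if it is an isolated point of $\mathcal{S}_G(A)$. *)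

theory Defs
  imports "HOL-Analysis.Analysis" "HOL-Algebra.Group"
begin

section \<open>Topological preliminaries\<close>

definition dense_in :: "'a topology \<Rightarrow> 'a set \<Rightarrow> bool" where
  "dense_in X S \<longleftrightarrow> S \<subseteq> topspace X \<and> X closure_of S = topspace X"

definition nowhere_dense_in :: "'a topology \<Rightarrow> 'a set \<Rightarrow> bool" where
  "nowhere_dense_in X S \<longleftrightarrow> S \<subseteq> topspace X \<and> X interior_of (X closure_of S) = {}"

definition meager_in :: "'a topology \<Rightarrow> 'a set \<Rightarrow> bool" where
  "meager_in X S \<longleftrightarrow> (\<exists>\<F>. countable \<F> \<and> (\<forall>N\<in>\<F>. nowhere_dense_in X N) \<and> S = \<Union>\<F>)"

definition comeager_in :: "'a topology \<Rightarrow> 'a set \<Rightarrow> bool" where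
  "comeager_in X S \<longleftrightarrow> S \<subseteq> topspace X \<and> meager_in X (topspace X - S)"

definition isolated_points :: "'a topology \<Rightarrow> 'a set" where
  "isolated_points X = {x \<in> topspace X. openin X {x}}"

definition vietoris_topology :: "'a topology \<Rightarrow> 'a set topology" where
  "vietoris_topology X = topology_generated_by
     ({{K. closedin X K \<and> K \<noteq> {} \<and> K \<subseteq> U} | U. openin X U} \<union>
      {{K. closedin X K \<and> K \<inter> U \<noteq> {}} | U. openin X U})"

lemma topspace_vietoris_topology:
  "topspace (vietoris_topology X) = {K. closedin X K \<and> K \<noteq> {}}"
proof
  show "topspace (vietoris_topology X) \<subseteq> {K. closedin X K \<and> K \<noteq> {}}"
    unfolding vietoris_topology_def topology_generated_by_topspace by blast
  have "K \<in> topspace (vietoris_topology X)" if "closedin X K" "K \<noteq> {}" for K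
  proof -
    have "K \<in> {K. closedin X K \<and> K \<noteq> {} \<and> K \<subseteq> topspace X}"
      using that closedin_subset by blast
    moreover have "openin X (topspace X)" by simp
    ultimately show ?thesis
      unfolding vietoris_topology_def topology_generated_by_topspace by blast
  qed
  then show "{K. closedin X K \<and> K \<noteq> {}} \<subseteq> topspace (vietoris_topology X)" by blast
qed

section \<open>The Cantor space and its homeomorphism group\<close>

definition cantor_space :: "(nat \<Rightarrow> bool) topology" where
  "cantor_space = product_topology (\<lambda>_. discrete_topology UNIV) UNIV"

definition cantor_dist :: "(nat \<Rightarrow> bool) \<Rightarrow> (nat \<Rightarrow> bool) \<Rightarrow> real" where
  "cantor_dist x y = (if x = y then 0 else (1 / 2) ^ (LEAST n. x n \<noteq> y n))"

definition cantor_metric :: "(nat \<Rightarrow> bool) metric" where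
  "cantor_metric = metric (UNIV, cantor_dist)"

lemma topspace_cantor_space [simp]: "topspace cantor_space = UNIV"
  by (simp add: cantor_space_def)

lemma cantor_dist_le_iff: "cantor_dist x y \<le> (1 / 2) ^ n \<longleftrightarrow> (\<forall>i<n. x i = y i)"
proof (cases "x = y")
  case False
  then obtain k where "x k \<noteq> y k" by blast
  then have L: "x (LEAST n. x n \<noteq> y n) \<noteq> y (LEAST n. x n \<noteq> y n)"
    by (rule LeastI)
  have "cantor_dist x y \<le> (1 / 2) ^ n \<longleftrightarrow> n \<le> (LEAST n. x n \<noteq> y n)"
    using False by (simp add: cantor_dist_def power_decreasing_iff)
  also have "\<dots> \<longleftrightarrow> (\<forall>i<n. x i = y i)"
    using L not_less_Least[of _ "\<lambda>n. x n \<noteq> y n"] by (meson leI less_le_trans)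
  finally show ?thesis .
qed (simp add: cantor_dist_def)

lemma cantor_dist_nonneg: "0 \<le> cantor_dist x y"
  by (simp add: cantor_dist_def)

lemma cantor_dist_commute: "cantor_dist x y = cantor_dist y x"
proof -
  have "(\<lambda>n. x n \<noteq> y n) = (\<lambda>n. y n \<noteq> x n)" by blast
  then show ?thesis unfolding cantor_dist_def by metis
qed

lemma cantor_dist_ge:
  assumes "x n \<noteq> y n"
  shows "(1 / 2) ^ n \<le> cantor_dist x y"
proof -
  have "x \<noteq> y" using assms by blast
  moreover have "(LEAST n. x n \<noteq> y n) \<le> n" using assms by (rule Least_le)
  ultimately show ?thesis
    by (simp add: cantor_dist_def power_decreasing)
qed

lemma cantor_dist_triangle: "cantor_dist x z \<le> cantor_dist x y + cantor_dist y z"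
proof (cases "x = z")
  case True
  then have "cantor_dist x z = 0" by (simp add: cantor_dist_def)
  then show ?thesis using cantor_dist_nonneg[of x y] cantor_dist_nonneg[of y z] by linarith
next
  case False
  define n where "n = (LEAST n. x n \<noteq> z n)"
  have eq: "cantor_dist x z = (1 / 2) ^ n"
    using False by (simp add: cantor_dist_def n_def)
  from False obtain k where "x k \<noteq> z k" by blast
  then have n: "x n \<noteq> z n" unfolding n_def by (rule LeastI)
  show ?thesis
  proof (cases "x n = y n")
    case True
    with n have "y n \<noteq> z n" by metis
    from cantor_dist_ge[of y n z, OF this] show ?thesis
      using eq cantor_dist_nonneg[of x y] by linarith
  next
    case False
    from cantor_dist_ge[of x n y, OF this] show ?thesis
      using eq cantor_dist_nonneg[of y z] by linarith
  qed
qed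

lemma Metric_space_cantor: "Metric_space UNIV cantor_dist"
proof
  show "cantor_dist x y = 0 \<longleftrightarrow> x = y" for x y by (simp add: cantor_dist_def)
qed (rule cantor_dist_nonneg cantor_dist_commute cantor_dist_triangle)+

lemma mspace_cantor_metric [simp]: "mspace cantor_metric = UNIV"
  and mdist_cantor_metric [simp]: "mdist cantor_metric = cantor_dist"
  by (simp_all add: cantor_metric_def Metric_space.mspace_metric Metric_space.mdist_metric
      Metric_space_cantor)

lemma openin_cantor_space:
  "openin cantor_space U \<longleftrightarrow>
     (\<forall>x\<in>U. \<exists>V. finite {i. V i \<noteq> UNIV} \<and> x \<in> Pi UNIV V \<and> Pi UNIV V \<subseteq> U)"
  unfolding cantor_space_def openin_product_topology_alt by (simp add: PiE_UNIV_domain)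

lemma mtopology_of_cantor_metric: "mtopology_of cantor_metric = cantor_space"
proof -
  interpret Metric_space UNIV cantor_dist by (rule Metric_space_cantor)
  have cyl: "\<exists>V. finite {i. V i \<noteq> UNIV} \<and> x \<in> Pi UNIV V \<and> Pi UNIV V \<subseteq> U"
    if "r > 0" and r: "mball x r \<subseteq> U" for x r U
  proof -
    obtain n where n: "(1 / 2) ^ n < r"
      using real_arch_pow_inv[of r "1/2"] \<open>r > 0\<close> by auto
    define V where "V = (\<lambda>i. if i < n then {x i} else UNIV)"
    have "{i. V i \<noteq> UNIV} \<subseteq> {..<n}" by (auto simp: V_def split: if_splits)
    then have "finite {i. V i \<noteq> UNIV}" by (rule finite_subset) simp
    moreover have "x \<in> Pi UNIV V" by (simp add: V_def Pi_def)
    moreover have "Pi UNIV V \<subseteq> U"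
    proof
      fix y assume y: "y \<in> Pi UNIV V"
      have "x i = y i" if "i < n" for i
      proof -
        have "y i \<in> V i" using y by (rule Pi_mem) simp
        then have "y i = x i" unfolding V_def if_P[OF that] by (rule singletonD)
        then show ?thesis by (rule sym)
      qed
      then have "cantor_dist x y \<le> (1 / 2) ^ n" unfolding cantor_dist_le_iff by blast
      then have "y \<in> mball x r" using n by simp
      then show "y \<in> U" using r by (rule subsetD[rotated])
    qed
    ultimately show ?thesis by blast
  qed
  have ball: "\<exists>r>0. mball x r \<subseteq> U"
    if fin: "finite {i. V i \<noteq> UNIV}" and x: "x \<in> Pi UNIV V" and V: "Pi UNIV V \<subseteq> U"
    for x :: "nat \<Rightarrow> bool" and V U
  proof -
    obtain N where N: "\<forall>i\<in>{i. V i \<noteq> UNIV}. i < N"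
      using fin unfolding finite_nat_set_iff_bounded by (rule exE)
    have "mball x ((1 / 2) ^ N) \<subseteq> U"
    proof
      fix y assume "y \<in> mball x ((1 / 2) ^ N)"
      then have "cantor_dist x y \<le> (1 / 2) ^ N" by simp
      then have eq: "\<forall>i<N. x i = y i" unfolding cantor_dist_le_iff .
      have "y i \<in> V i" for i
      proof (cases "V i = UNIV")
        case False
        then have "i < N" using N by blast
        then have "x i = y i" using eq by blast
        moreover have "x i \<in> V i" using x by (rule Pi_mem) simp
        ultimately show ?thesis by (rule subst)
      qed (simp only: UNIV_I)
      then have "y \<in> Pi UNIV V" by (rule Pi_I)
      then show "y \<in> U" using V by (rule subsetD[rotated])
    qed
    moreover have "(0 :: real) < (1 / 2) ^ N" by simp
    ultimately show ?thesis by blast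
  qed
  have "openin mtopology U \<longleftrightarrow> openin cantor_space U" for U
    unfolding openin_mtopology openin_cantor_space
  proof (intro iffI ballI conjI allI impI subset_UNIV)
    fix x assume "U \<subseteq> UNIV \<and> (\<forall>x. x \<in> U \<longrightarrow> (\<exists>r>0. mball x r \<subseteq> U))" "x \<in> U"
    then obtain r where "r > 0" "mball x r \<subseteq> U" by blast
    then show "\<exists>V. finite {i. V i \<noteq> UNIV} \<and> x \<in> Pi UNIV V \<and> Pi UNIV V \<subseteq> U"
      by (rule cyl)
  next
    fix x assume "\<forall>x\<in>U. \<exists>V. finite {i. V i \<noteq> UNIV} \<and> x \<in> Pi UNIV V \<and> Pi UNIV V \<subseteq> U"
      and "x \<in> U"
    then have "\<exists>V. finite {i. V i \<noteq> UNIV} \<and> x \<in> Pi UNIV V \<and> Pi UNIV V \<subseteq> U"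
      by (rule bspec)
    then obtain V where "finite {i. V i \<noteq> UNIV}" "x \<in> Pi UNIV V" "Pi UNIV V \<subseteq> U"
      by (elim exE conjE)
    then show "\<exists>r>0. mball x r \<subseteq> U" by (rule ball)
  qed
  then show ?thesis
    by (simp add: cantor_metric_def mtopology_of_def topology_eq)
qed

definition homeo_group :: "((nat \<Rightarrow> bool) \<Rightarrow> (nat \<Rightarrow> bool)) monoid" where
  "homeo_group = \<lparr>carrier = {f. homeomorphic_map cantor_space cantor_space f},
                  mult = (\<circ>), one = id\<rparr>"

lemma carrier_homeo_group: "f \<in> carrier homeo_group \<longleftrightarrow> homeomorphic_map cantor_space cantor_space f"
  by (simp add: homeo_group_def)

lemma mult_homeo_group: "f \<otimes>\<^bsub>homeo_group\<^esub> g = f \<circ> g"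
  by (simp add: homeo_group_def)

lemma one_homeo_group: "\<one>\<^bsub>homeo_group\<^esub> = id"
  by (simp add: homeo_group_def)

lemma group_homeo_group: "group homeo_group"
proof (rule groupI)
  fix f assume "f \<in> carrier homeo_group"
  then obtain g where g: "homeomorphic_maps cantor_space cantor_space f g"
    unfolding carrier_homeo_group homeomorphic_map_maps by (rule exE)
  have "g \<in> carrier homeo_group"
    unfolding carrier_homeo_group homeomorphic_map_maps
    by (rule exI[where x = f]) (use g homeomorphic_maps_sym in blast)
  moreover have "g (f x) = x" for x
    using g unfolding homeomorphic_maps_def topspace_cantor_space by blast
  then have "g \<otimes>\<^bsub>homeo_group\<^esub> f = \<one>\<^bsub>homeo_group\<^esub>"
    unfolding mult_homeo_group one_homeo_group fun_eq_iff[of "g \<circ> f"] comp_apply id_apply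
    by (rule allI)
  ultimately show "\<exists>g\<in>carrier homeo_group. g \<otimes>\<^bsub>homeo_group\<^esub> f = \<one>\<^bsub>homeo_group\<^esub>"
    by blast
next
  fix f g assume "f \<in> carrier homeo_group" "g \<in> carrier homeo_group"
  then show "f \<otimes>\<^bsub>homeo_group\<^esub> g \<in> carrier homeo_group"
    unfolding carrier_homeo_group mult_homeo_group by (rule homeomorphic_map_compose[rotated])
qed (simp_all only: carrier_homeo_group mult_homeo_group one_homeo_group o_assoc id_o
      homeomorphic_map_id)

text \<open>The topology of uniform convergence; as the Cantor space is compact, it does not
  depend on the choice of the compatible metric.\<close>

definition homeo_topology :: "((nat \<Rightarrow> bool) \<Rightarrow> (nat \<Rightarrow> bool)) topology" where
  "homeo_topology =
     subtopology (mtopology_of (cfunspace cantor_space cantor_metric)) (carrier homeo_group)"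

lemma topspace_homeo_topology: "topspace homeo_topology = carrier homeo_group"
proof -
  interpret Metric_space UNIV cantor_dist by (rule Metric_space_cantor)
  have le1: "cantor_dist x y \<le> 1" for x y
    using cantor_dist_le_iff[of x y 0] by simp
  have bdd: "mbounded S" for S
    unfolding mbounded_def
  proof (intro exI)
    show "S \<subseteq> mcball (\<lambda>_. False) 1"
      by (rule subsetI) (simp add: le1)
  qed
  have "carrier homeo_group \<subseteq> mspace (cfunspace cantor_space cantor_metric)"
  proof
    fix f assume "f \<in> carrier homeo_group"
    then have "continuous_map cantor_space cantor_space f"
      by (simp add: homeo_group_def homeomorphic_imp_continuous_map)
    then show "f \<in> mspace (cfunspace cantor_space cantor_metric)"
      by (simp add: bdd mtopology_of_cantor_metric)
  qed
  then show ?thesis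
    unfolding homeo_topology_def topspace_subtopology topspace_mtopology_of by (rule Int_absorb1)
qed

section \<open>Actions on the Cantor space\<close>

text \<open>The group is discrete, so a continuous action is a homomorphism into the homeomorphism
  group.\<close>

definition actions :: "('g, 'm) monoid_scheme \<Rightarrow> ('g \<Rightarrow> (nat \<Rightarrow> bool) \<Rightarrow> (nat \<Rightarrow> bool)) set" where
  "actions G = hom G homeo_group \<inter> extensional (carrier G)"

definition action_topology ::
  "('g, 'm) monoid_scheme \<Rightarrow> ('g \<Rightarrow> (nat \<Rightarrow> bool) \<Rightarrow> (nat \<Rightarrow> bool)) topology" where
  "action_topology G = subtopology (product_topology (\<lambda>_. homeo_topology) (carrier G)) (actions G)"

lemma topspace_action_topology: "topspace (action_topology G) = actions G"
  by (auto simp: action_topology_def actions_def hom_def topspace_homeo_topology PiE_def)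

definition conjugate_action ::
  "('g, 'm) monoid_scheme \<Rightarrow> ((nat \<Rightarrow> bool) \<Rightarrow> (nat \<Rightarrow> bool)) \<Rightarrow>
   ('g \<Rightarrow> (nat \<Rightarrow> bool) \<Rightarrow> (nat \<Rightarrow> bool)) \<Rightarrow> ('g \<Rightarrow> (nat \<Rightarrow> bool) \<Rightarrow> (nat \<Rightarrow> bool))" where
  "conjugate_action G \<phi> \<alpha> = (\<lambda>g\<in>carrier G. \<phi> \<circ> \<alpha> g \<circ> inv_into UNIV \<phi>)"

definition conjugacy_class ::
  "('g, 'm) monoid_scheme \<Rightarrow> ('g \<Rightarrow> (nat \<Rightarrow> bool) \<Rightarrow> (nat \<Rightarrow> bool)) \<Rightarrow>
   ('g \<Rightarrow> (nat \<Rightarrow> bool) \<Rightarrow> (nat \<Rightarrow> bool)) set" where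
  "conjugacy_class G \<alpha> = {conjugate_action G \<phi> \<alpha> | \<phi>. \<phi> \<in> carrier homeo_group}"

definition strong_topological_Rokhlin_property :: "('g, 'm) monoid_scheme \<Rightarrow> bool" where
  "strong_topological_Rokhlin_property G \<longleftrightarrow>
     (\<exists>\<alpha>\<in>actions G. comeager_in (action_topology G) (conjugacy_class G \<alpha>))"

section \<open>Subshifts\<close>

definition full_shift :: "('g, 'm) monoid_scheme \<Rightarrow> 'a set \<Rightarrow> ('g \<Rightarrow> 'a) topology" where
  "full_shift G A = product_topology (\<lambda>_. discrete_topology A) (carrier G)"

definition shift :: "('g, 'm) monoid_scheme \<Rightarrow> 'g \<Rightarrow> ('g \<Rightarrow> 'a) \<Rightarrow> ('g \<Rightarrow> 'a)" where
  "shift G g x = (\<lambda>h\<in>carrier G. x (inv\<^bsub>G\<^esub> g \<otimes>\<^bsub>G\<^esub> h))"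

definition subshifts :: "('g, 'm) monoid_scheme \<Rightarrow> 'a set \<Rightarrow> ('g \<Rightarrow> 'a) set set" where
  "subshifts G A = {X. closedin (full_shift G A) X \<and> X \<noteq> {} \<and>
                       (\<forall>g\<in>carrier G. shift G g ` X \<subseteq> X)}"

definition subshift_topology ::
  "('g, 'm) monoid_scheme \<Rightarrow> 'a set \<Rightarrow> ('g \<Rightarrow> 'a) set topology" where
  "subshift_topology G A = subtopology (vietoris_topology (full_shift G A)) (subshifts G A)"

lemma topspace_subshift_topology: "topspace (subshift_topology G A) = subshifts G A"
  by (auto simp: subshift_topology_def topspace_vietoris_topology subshifts_def)

end

theory Submission
  imports Defs
begin

text \<open>
  Call a locally constant function \<open>P\<close> from the Cantor space to the natural numbers a label.
  Under an action \<open>\<alpha>\<close> a point \<open>x\<close> has the itinerary \<open>g \<mapsto> P (\<alpha> (g\<inverse>) x)\<close>, and the itineraries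
  of all points form a subshift, which is a factor of \<open>\<alpha>\<close>. Sequences of finer and finer labels
  separate points, so an action is the inverse limit of its itinerary systems. A system of
  itineraries is called isolated if the patterns that it shows on some finite window determine it
  among all systems of itineraries.

  An action is called generic if it meets two kinds of requirements. First, every label has
  arbitrarily fine refinements whose itineraries form an isolated system. Second, whenever the system
  of a label \<open>P\<close> is the image of an isolated system \<open>Z\<close> under merging of symbols, and is isolated
  itself, then \<open>P\<close> refines to a label whose system is exactly \<open>Z\<close>. For two generic actions these
  properties feed a back-and-forth construction: a pair of labels with the same isolated system is
  refined alternately on both sides, always keeping the two systems equal, until the labels separate
  all points (\<open>back_and_forth\<close>). Sending \<open>x\<close> to the point with the same itineraries for all labels of
  the sequence is then a conjugacy (\<open>generic_conjugate\<close>). So it suffices that the generic actions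
  contain a countable intersection of dense open sets.

  The requirements are countable in number because a locally constant function reads finitely many
  bits, and an isolated system is coded by a finite set of finite patterns. Each requirement is
  open because an isolated system survives small perturbations of the action.

  For density, the common tool is \<open>realise_system\<close>: a compact zero-dimensional system \<open>W\<close> showing the
  same patterns on a finite window as the given action \<open>\<alpha>\<close> is a factor of an action close to \<open>\<alpha>\<close>.
  Indeed, the product of \<open>W\<close> with a trivially acted-on Cantor space is again a Cantor space, and the
  identification can be chosen to match the patterns. For the first requirement, encode the
  desired closeness in a fine label; near the subshift of its itineraries there is an isolated
  subshift with the same patterns, by hypothesis, and this is taken as \<open>W\<close>
  (\<open>dense_isolated_refinement\<close>). For the second, \<open>W\<close> is the fibre product of the action itself and
  \<open>Z\<close> over their common factor (\<open>dense_lift\<close>).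
\<close>

section \<open>Locally constant functions\<close>

abbreviation locally_constant :: "'a topology \<Rightarrow> ('a \<Rightarrow> 'b) \<Rightarrow> bool" where
  "locally_constant X P \<equiv> continuous_map X (discrete_topology UNIV) P"

lemma locally_constant_iff:
  "locally_constant X P \<longleftrightarrow> (\<forall>v. openin X {x \<in> topspace X. P x = v})"
proof
  assume "locally_constant X P"
  then have "openin X {x \<in> topspace X. P x \<in> {v}}" for v
    by (rule openin_continuous_map_preimage) simp
  then show "\<forall>v. openin X {x \<in> topspace X. P x = v}" by simp
next
  assume *: "\<forall>v. openin X {x \<in> topspace X. P x = v}"
  have "openin X {x \<in> topspace X. P x \<in> U}" for U
  proof -
    have "{x \<in> topspace X. P x \<in> U} = (\<Union>v\<in>U. {x \<in> topspace X. P x = v})" by auto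
    then show ?thesis using * by auto
  qed
  then show "locally_constant X P" by (simp add: continuous_map_def)
qed

lemma locally_constant_comp:
  assumes "locally_constant X P"
  shows "locally_constant X (\<lambda>x. h (P x))"
  using continuous_map_compose[OF assms, of "discrete_topology UNIV" h] by (simp add: comp_def)

lemma locally_constant_comp2:
  assumes "locally_constant X P" "locally_constant X Q"
  shows "locally_constant X (\<lambda>x. h (P x) (Q x))"
  unfolding locally_constant_iff
proof
  fix v
  have "{x \<in> topspace X. h (P x) (Q x) = v} =
    (\<Union>(a, b)\<in>{(a, b). h a b = v}. {x \<in> topspace X. P x = a} \<inter> {x \<in> topspace X. Q x = b})" by auto
  moreover have "openin X \<dots>"
    using assms unfolding locally_constant_iff by (intro openin_Union) auto
  ultimately show "openin X {x \<in> topspace X. h (P x) (Q x) = v}" by simp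
qed

lemma locally_constant_compose:
  assumes "continuous_map X Y f" "locally_constant Y P"
  shows "locally_constant X (\<lambda>x. P (f x))"
  using continuous_map_compose[OF assms] by (simp add: comp_def)

lemma locally_constant_restrict:
  assumes "finite F" "\<And>f. f \<in> F \<Longrightarrow> locally_constant X (P f)"
  shows "locally_constant X (\<lambda>x. \<lambda>f\<in>F. P f x)"
  using assms
proof (induction F rule: finite_induct)
  case empty
  then show ?case by (simp add: restrict_def)
next
  case (insert a F)
  have eq: "(\<lambda>f\<in>insert a F. P f x) = ((\<lambda>f\<in>F. P f x)(a := P a x))" for x
    by (auto simp: restrict_def fun_eq_iff)
  show ?case unfolding eq
  proof (rule locally_constant_comp2[of X _ _ "\<lambda>p v. p(a := v)"])
    show "locally_constant X (\<lambda>x. \<lambda>f\<in>F. P f x)" by (rule insert.IH) (rule insert.prems, rule insertI2)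
    show "locally_constant X (P a)" by (rule insert.prems) (rule insertI1)
  qed
qed

lemma openin_locally_constant_Collect:
  assumes "locally_constant X P"
  shows "openin X {x \<in> topspace X. R (P x)}"
  using openin_continuous_map_preimage[OF assms, of "{v. R v}"] by simp

lemma closedin_locally_constant_Collect:
  assumes "locally_constant X P"
  shows "closedin X {x \<in> topspace X. R (P x)}"
  using closedin_continuous_map_preimage[OF assms, of "{v. R v}"] by simp

lemma finite_locally_constant_image:
  assumes "locally_constant X P" "compact_space X"
  shows "finite (P ` topspace X)"
  using image_compactin[OF _ assms(1), of "topspace X"] assms(2)
  by (simp add: compact_space_def compactin_discrete_topology)

section \<open>The Cantor space\<close>

lemma compact_space_cantor: "compact_space cantor_space"
  by (simp add: cantor_space_def compact_space_product_topology compact_space_discrete_topology)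

lemma Hausdorff_space_cantor: "Hausdorff_space cantor_space"
  by (simp add: cantor_space_def Hausdorff_space_product_topology)

lemma continuous_map_cantor_iff:
  "continuous_map X cantor_space f \<longleftrightarrow> (\<forall>i. locally_constant X (\<lambda>x. f x i))"
  by (simp add: cantor_space_def continuous_map_componentwise_UNIV)

lemma locally_constant_cantor_nth: "locally_constant cantor_space (\<lambda>x. x i)"
  unfolding cantor_space_def by (rule continuous_map_product_projection) simp

lemma restrict_eq_iff: "restrict f F = restrict g F \<longleftrightarrow> (\<forall>x\<in>F. f x = g x)"
proof
  assume eq: "restrict f F = restrict g F"
  show "\<forall>x\<in>F. f x = g x"
  proof
    fix x assume "x \<in> F"
    then show "f x = g x" using fun_cong[OF eq, of x] by simp
  qed
next
  assume "\<forall>x\<in>F. f x = g x"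
  then show "restrict f F = restrict g F" by (intro restrict_ext) blast
qed

definition agree :: "nat \<Rightarrow> (nat \<Rightarrow> 'b) \<Rightarrow> (nat \<Rightarrow> 'b) \<Rightarrow> bool" where
  "agree n x y \<longleftrightarrow> (\<forall>i<n. x i = y i)"

lemma agree_refl [simp]: "agree n x x"
  by (simp add: agree_def)

lemma agree_sym: "agree n x y \<Longrightarrow> agree n y x"
  by (simp add: agree_def)

lemma agree_trans: "agree n x y \<Longrightarrow> agree n y z \<Longrightarrow> agree n x z"
  by (simp add: agree_def)

lemma agree_mono: "agree n x y \<Longrightarrow> m \<le> n \<Longrightarrow> agree m x y"
  by (simp add: agree_def)

lemma agreeD: "agree n x y \<Longrightarrow> i < n \<Longrightarrow> x i = y i"
  by (simp add: agree_def)

lemma openin_cantor_cylinder: "openin cantor_space {y. agree n y x}"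
proof -
  have "locally_constant cantor_space (\<lambda>y. restrict y {..<n})"
    using locally_constant_restrict[of "{..<n}" cantor_space "\<lambda>i y. y i"]
      locally_constant_cantor_nth by simp
  from openin_locally_constant_Collect[OF this, of "\<lambda>v. v = restrict x {..<n}"]
  show ?thesis by (simp add: restrict_eq_iff agree_def Ball_def)
qed

lemma cantor_open_contains_cylinder:
  assumes "openin cantor_space U" "x \<in> U"
  shows "\<exists>n. \<forall>y. agree n y x \<longrightarrow> y \<in> U"
proof -
  obtain V where V: "finite {i. V i \<noteq> UNIV}" "x \<in> Pi UNIV V" "Pi UNIV V \<subseteq> U"
    using assms unfolding openin_cantor_space by metis
  obtain n where n: "\<forall>i\<in>{i. V i \<noteq> UNIV}. i < n"
    using V(1) unfolding finite_nat_set_iff_bounded by (rule exE)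
  have "y \<in> U" if y: "agree n y x" for y
  proof -
    have "y \<in> Pi UNIV V"
    proof (rule Pi_I)
      fix i show "y i \<in> V i"
      proof (cases "V i = UNIV")
        case False
        then have "y i = x i" using n agreeD[OF y] by blast
        then show ?thesis using V(2) by (auto simp: Pi_iff)
      qed auto
    qed
    then show ?thesis using V(3) by (rule subsetD[rotated])
  qed
  then show ?thesis by blast
qed

text \<open>By compactness, a locally constant function on the Cantor space reads only a finite
  initial segment of its argument.\<close>

lemma locally_constant_cantor_iff:
  "locally_constant cantor_space P \<longleftrightarrow> (\<exists>n. \<forall>x y. agree n x y \<longrightarrow> P x = P y)"
proof
  assume P: "locally_constant cantor_space P"
  have "\<exists>n. \<forall>y. agree n y x \<longrightarrow> P y = P x" for x
  proof -
    have "openin cantor_space {y. P y = P x}"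
      using openin_locally_constant_Collect[OF P, of "\<lambda>v. v = P x"] by simp
    then have "\<exists>n. \<forall>y. agree n y x \<longrightarrow> y \<in> {y. P y = P x}"
      by (rule cantor_open_contains_cylinder) simp
    then show ?thesis unfolding mem_Collect_eq .
  qed
  then obtain N where N: "\<And>x y. agree (N x) y x \<Longrightarrow> P y = P x" by metis
  define C where "C x = {y. agree (N x) y x}" for x
  have "\<forall>U\<in>range C. openin cantor_space U"
    unfolding C_def using openin_cantor_cylinder by blast
  moreover have "topspace cantor_space \<subseteq> \<Union> (range C)" unfolding C_def by auto
  ultimately obtain Fs where Fs: "finite Fs" "Fs \<subseteq> range C" "topspace cantor_space \<subseteq> \<Union> Fs"
    using compact_space_cantor[unfolded compact_space_alt, THEN spec, of "range C"] by blast
  obtain S where S: "finite S" "Fs = C ` S" using finite_subset_image[OF Fs(1,2)] by blast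
  obtain m where m: "\<And>x. x \<in> S \<Longrightarrow> N x \<le> m"
    using finite_imageI[OF S(1), of N] unfolding finite_nat_set_iff_bounded_le by blast
  have "P u = P v" if uv: "agree m u v" for u v
  proof -
    obtain x where x: "x \<in> S" "v \<in> C x" using Fs(3) S(2) by auto
    have v: "agree (N x) v x" using x(2) by (simp add: C_def)
    have "agree (N x) u v" using uv m[OF x(1)] by (rule agree_mono)
    then have "agree (N x) u x" using v by (rule agree_trans)
    then show ?thesis using N[OF v] N[of x u] by argo
  qed
  then show "\<exists>n. \<forall>x y. agree n x y \<longrightarrow> P x = P y" by blast
next
  assume "\<exists>n. \<forall>x y. agree n x y \<longrightarrow> P x = P y"
  then obtain n where n: "\<And>x y. agree n x y \<Longrightarrow> P x = P y" by blast
  have "openin cantor_space {x \<in> topspace cantor_space. P x = v}" for v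
  proof (subst openin_subopen, intro ballI)
    fix x assume x: "x \<in> {x \<in> topspace cantor_space. P x = v}"
    have "{y. agree n y x} \<subseteq> {x \<in> topspace cantor_space. P x = v}"
    proof
      fix y assume "y \<in> {y. agree n y x}"
      then have "P y = P x" using n by blast
      then show "y \<in> {x \<in> topspace cantor_space. P x = v}" using x by simp
    qed
    then show "\<exists>T. openin cantor_space T \<and> x \<in> T \<and> T \<subseteq> {x \<in> topspace cantor_space. P x = v}"
      using openin_cantor_cylinder[of n x] by (intro exI[of _ "{y. agree n y x}"]) simp
  qed
  then show "locally_constant cantor_space P" unfolding locally_constant_iff by blast
qed

lemma countable_locally_constant_cantor:
  "countable {P :: (nat \<Rightarrow> bool) \<Rightarrow> 'b::countable. locally_constant cantor_space P}"
proof -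
  define D where "D n = {P :: (nat \<Rightarrow> bool) \<Rightarrow> 'b. \<forall>x y. agree n x y \<longrightarrow> P x = P y}" for n
  have "countable (D n)" for n
  proof -
    define r where "r P = (\<lambda>S\<in>Pow {..<n}. P (\<lambda>i. i \<in> S))" for P :: "(nat \<Rightarrow> bool) \<Rightarrow> 'b"
    have "r ` D n \<subseteq> Pow {..<n} \<rightarrow>\<^sub>E UNIV" unfolding r_def by (intro image_subsetI) (simp add: restrict_PiE_iff)
    moreover have "countable (Pow {..<n} \<rightarrow>\<^sub>E (UNIV :: 'b set))"
      by (intro countable_PiE) auto
    ultimately have "countable (r ` D n)" by (rule countable_subset)
    moreover have "inj_on r (D n)"
    proof (rule inj_onI)
      fix P Q assume PQ: "P \<in> D n" "Q \<in> D n" and eq: "r P = r Q"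
      have "P x = Q x" for x
      proof -
        let ?S = "{i. i < n \<and> x i}"
        have "P (\<lambda>i. i \<in> ?S) = Q (\<lambda>i. i \<in> ?S)"
          using fun_cong[OF eq, of ?S] by (simp add: r_def subset_eq)
        moreover have xS: "agree n x (\<lambda>i. i \<in> ?S)" by (simp add: agree_def)
        moreover have "P x = P (\<lambda>i. i \<in> ?S)" using PQ(1) xS unfolding D_def by blast
        moreover have "Q x = Q (\<lambda>i. i \<in> ?S)" using PQ(2) xS unfolding D_def by blast
        ultimately show ?thesis by simp
      qed
      then show "P = Q" by blast
    qed
    ultimately show ?thesis by (rule countable_image_inj_on)
  qed
  then have "countable (\<Union>n. D n)" by blast
  moreover have "{P :: (nat \<Rightarrow> bool) \<Rightarrow> 'b. locally_constant cantor_space P} = (\<Union>n. D n)"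
    unfolding D_def locally_constant_cantor_iff by blast
  ultimately show ?thesis by simp
qed

section \<open>Perfect compact subsets of the Cantor space\<close>

lemma card_below_enumerate:
  fixes S :: "nat set"
  assumes "infinite S"
  shows "card (S \<inter> {..<enumerate S k}) = k"
proof -
  have "S \<inter> {..<enumerate S k} = enumerate S ` {..<k}"
  proof
    show "S \<inter> {..<enumerate S k} \<subseteq> enumerate S ` {..<k}"
    proof
      fix n assume n: "n \<in> S \<inter> {..<enumerate S k}"
      then obtain j where j: "enumerate S j = n" using enumerate_Ex[OF assms] by auto
      then have "j < k" using n enumerate_mono_iff[OF assms] by auto
      then show "n \<in> enumerate S ` {..<k}" using j by auto
    qed
    show "enumerate S ` {..<k} \<subseteq> S \<inter> {..<enumerate S k}"
      using assms by (auto simp: enumerate_in_set enumerate_mono)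
  qed
  moreover have "inj_on (enumerate S) {..<k}"
    using strict_mono_enumerate[OF assms] strict_mono_imp_inj_on inj_on_subset by blast
  ultimately show ?thesis by (simp add: card_image)
qed

lemma enumerate_eqI:
  fixes S :: "nat set"
  assumes "infinite S" "n \<in> S" "card (S \<inter> {..<n}) = k"
  shows "enumerate S k = n"
proof -
  obtain j where j: "enumerate S j = n" using enumerate_Ex assms by blast
  then show ?thesis using card_below_enumerate[OF assms(1), of j] assms(3) by simp
qed

text \<open>A closed set \<open>K\<close> of infinite sequences is the set of branches of a tree of finite words. The
  levels at which the branch \<open>x\<close> passes a word with two successors are its branching levels; if \<open>K\<close> is
  perfect there are infinitely many of them, and the bits of \<open>x\<close> at these levels are free and
  determine \<open>x\<close>. Deleting all other bits identifies \<open>K\<close> with the full binary tree.\<close>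

definition branching :: "(nat \<Rightarrow> bool) set \<Rightarrow> (nat \<Rightarrow> bool) \<Rightarrow> nat set" where
  "branching K x =
     {n. \<exists>y\<in>K. \<exists>z\<in>K. agree n y x \<and> agree n z x \<and> y n \<noteq> z n}"

definition branch_bits :: "(nat \<Rightarrow> bool) set \<Rightarrow> (nat \<Rightarrow> bool) \<Rightarrow> (nat \<Rightarrow> bool)" where
  "branch_bits K x = (\<lambda>k. x (enumerate (branching K x) k))"

definition perfect_set :: "(nat \<Rightarrow> bool) set \<Rightarrow> bool" where
  "perfect_set K \<longleftrightarrow> (\<forall>x\<in>K. \<forall>n. \<exists>y\<in>K. y \<noteq> x \<and> agree n y x)"

lemma branching_cong:
  assumes "agree n x y" "k \<le> n"
  shows "k \<in> branching K x \<longleftrightarrow> k \<in> branching K y"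
proof -
  have xy: "agree k x y" using assms by (rule agree_mono)
  then have "agree k u x \<longleftrightarrow> agree k u y" for u
    using agree_trans[of k u] agree_sym[OF xy] by blast
  then show ?thesis unfolding branching_def by simp
qed

lemma first_difference:
  fixes x y :: "nat \<Rightarrow> bool"
  assumes "x \<noteq> y"
  obtains n where "agree n x y" "x n \<noteq> y n"
proof -
  have "\<exists>n. x n \<noteq> y n" using assms by blast
  then obtain n where n: "x n \<noteq> y n" "\<forall>i<n. \<not> x i \<noteq> y i"
    unfolding exists_least_iff[of "\<lambda>n. x n \<noteq> y n"] by blast
  have "agree n x y" using n(2) by (simp add: agree_def)
  then show ?thesis using n(1) by (rule that)
qed

lemma infinite_branching:
  assumes "perfect_set K" "x \<in> K"
  shows "infinite (branching K x)"
  unfolding infinite_nat_iff_unbounded_le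
proof
  fix m
  obtain y where y: "y \<in> K" "y \<noteq> x" "agree m y x"
    using assms unfolding perfect_set_def by metis
  obtain n where n: "agree n y x" "y n \<noteq> x n" using first_difference y(2) by blast
  have "m \<le> n" using n(2) agreeD[OF y(3)] by (meson not_le)
  moreover have "n \<in> branching K x" unfolding branching_def using n y(1) assms(2) agree_refl by blast
  ultimately show "\<exists>n\<ge>m. n \<in> branching K x" by blast
qed

text \<open>Whether a level is a branching level depends only on the bits before it.\<close>

lemma enumerate_branching_cong:
  assumes K: "perfect_set K" and xy: "x \<in> K" "y \<in> K"
    and agree: "agree (enumerate (branching K x) k) x y"
  shows "enumerate (branching K y) k = enumerate (branching K x) k"
proof (rule enumerate_eqI)
  let ?n = "enumerate (branching K x) k"
  show "infinite (branching K y)" using infinite_branching K xy by blast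
  have inf: "infinite (branching K x)" using infinite_branching K xy by blast
  show "?n \<in> branching K y"
    using branching_cong[OF agree, of ?n K] enumerate_in_set[OF inf] by blast
  have "branching K y \<inter> {..<?n} = branching K x \<inter> {..<?n}"
    using branching_cong[OF agree, of _ K] by auto
  then show "card (branching K y \<inter> {..<?n}) = k" using card_below_enumerate[OF inf] by simp
qed

lemma branch_bits_inj:
  assumes K: "perfect_set K"
  shows "inj_on (branch_bits K) K"
proof (rule inj_onI, rule ccontr)
  fix x y assume xy: "x \<in> K" "y \<in> K" and eq: "branch_bits K x = branch_bits K y" and "x \<noteq> y"
  then obtain n where n: "agree n x y" "x n \<noteq> y n" using first_difference by blast
  have "n \<in> branching K x" unfolding branching_def using xy n agree_sym[OF n(1)] agree_refl by blast
  then obtain k where k: "enumerate (branching K x) k = n"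
    using enumerate_Ex infinite_branching[OF K xy(1)] by blast
  then have "enumerate (branching K y) k = n"
    using enumerate_branching_cong[OF K xy, of k] n(1) by simp
  then have "x n = y n" using fun_cong[OF eq, of k] k unfolding branch_bits_def by simp
  then show False using n(2) by simp
qed

text \<open>At the next branching level both values occur, so any finite word is realised one bit at a
  time. With compactness this gives surjectivity.\<close>

lemma branch_bits_dense:
  assumes K: "perfect_set K" and "K \<noteq> {}"
  shows "\<exists>x\<in>K. agree m (branch_bits K x) b"
proof (induction m)
  case 0
  then show ?case using assms by (auto simp: agree_def)
next
  case (Suc m)
  then obtain x where x: "x \<in> K" "\<forall>i<m. branch_bits K x i = b i"
    unfolding agree_def by blast
  let ?n = "\<lambda>i. enumerate (branching K x) i"
  have inf: "infinite (branching K x)" using infinite_branching K x by blast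
  obtain y z where "y \<in> K" "z \<in> K" "agree (?n m) y x" "agree (?n m) z x" "y (?n m) \<noteq> z (?n m)"
    using enumerate_in_set[OF inf, of m] unfolding branching_def by blast
  then obtain y where y: "y \<in> K" "agree (?n m) x y" "y (?n m) = b m"
    using agree_sym by metis
  have en: "enumerate (branching K y) i = ?n i" if "i \<le> m" for i
  proof (rule enumerate_branching_cong[OF K x(1) y(1)])
    have "?n i \<le> ?n m" using that strict_mono_enumerate[OF inf] by (simp add: strict_mono_less_eq)
    then show "agree (?n i) x y" using agree_mono[OF y(2)] by blast
  qed
  have "branch_bits K y i = b i" if "i < Suc m" for i
  proof (cases "i = m")
    case True
    then show ?thesis using en y(3) by (simp add: branch_bits_def)
  next
    case False
    then have "i < m" using that by simp
    then have "?n i < ?n m" using inf by (rule enumerate_mono)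
    then have "y (?n i) = x (?n i)" using agreeD[OF y(2)] by simp
    then show ?thesis using en[of i] x(2) \<open>i < m\<close> by (simp add: branch_bits_def)
  qed
  then show ?case using y(1) unfolding agree_def by blast
qed

lemma branch_bits_continuous:
  assumes K: "perfect_set K"
  shows "continuous_map (subtopology cantor_space K) cantor_space (branch_bits K)"
  unfolding continuous_map_cantor_iff locally_constant_iff
proof (intro allI)
  fix k v
  let ?X = "subtopology cantor_space K"
  show "openin ?X {x \<in> topspace ?X. branch_bits K x k = v}"
  proof (subst openin_subopen, intro ballI)
    fix x assume x: "x \<in> {x \<in> topspace ?X. branch_bits K x k = v}"
    let ?n = "enumerate (branching K x) k"
    let ?T = "{y. agree (Suc ?n) y x} \<inter> K"
    have "openin ?X ?T" using openin_cantor_cylinder by (auto simp: openin_subtopology)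
    moreover have "branch_bits K y k = v" if "y \<in> ?T" for y
      proof -
      have sy: "agree (Suc ?n) x y" using that agree_sym by blast
      have "agree ?n x y" using agree_mono[OF sy] by simp
      moreover have "x ?n = y ?n" using agreeD[OF sy] by blast
      ultimately show ?thesis
        using enumerate_branching_cong[OF K, of x y k] x that by (simp add: branch_bits_def)
    qed
    ultimately show "\<exists>T. openin ?X T \<and> x \<in> T \<and> T \<subseteq> {x \<in> topspace ?X. branch_bits K x k = v}"
      using x by (intro exI[of _ ?T]) auto
  qed
qed

lemma perfect_set_homeomorphic_cantor:
  assumes clo: "closedin cantor_space K" and K: "perfect_set K" "K \<noteq> {}"
  shows "homeomorphic_map (subtopology cantor_space K) cantor_space (branch_bits K)"
proof (rule continuous_imp_homeomorphic_map)
  let ?X = "subtopology cantor_space K"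
  show comp: "compact_space ?X"
    using clo by (meson closedin_compact_space compact_space_cantor compact_space_subtopology)
  show cont: "continuous_map ?X cantor_space (branch_bits K)"
    using K(1) by (rule branch_bits_continuous)
  show "Hausdorff_space cantor_space" by (rule Hausdorff_space_cantor)
  show "inj_on (branch_bits K) (topspace ?X)" using branch_bits_inj[OF K(1)] by simp
  have "compactin cantor_space (branch_bits K ` topspace ?X)"
    using image_compactin[OF _ cont] comp compact_space_def by blast
  then have "closedin cantor_space (branch_bits K ` K)"
    using compactin_imp_closedin Hausdorff_space_cantor by fastforce
  then have op: "openin cantor_space (UNIV - branch_bits K ` K)" by (simp add: closedin_def)
  have "b \<in> branch_bits K ` K" for b
  proof (rule ccontr)
    assume "b \<notin> branch_bits K ` K"
    then have "b \<in> UNIV - branch_bits K ` K" by simp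
    with op obtain m where m: "\<And>y. agree m y b \<Longrightarrow> y \<in> UNIV - branch_bits K ` K"
      using cantor_open_contains_cylinder by metis
    obtain x where "x \<in> K" "agree m (branch_bits K x) b" using branch_bits_dense[OF K] by blast
    then show False using m by blast
  qed
  then show "branch_bits K ` topspace ?X = topspace cantor_space" by auto
qed

text \<open>Brouwer's characterisation of the Cantor space, for spaces given with an embedding into it.\<close>

theorem homeomorphic_cantor_space:
  assumes X: "compact_space X" "topspace X \<noteq> {}"
    and s: "continuous_map X cantor_space s" "inj_on s (topspace X)"
    and perf: "\<And>x. \<not> openin X {x}"
  shows "X homeomorphic_space cantor_space"
proof -
  let ?K = "s ` topspace X"
  have "compactin cantor_space ?K"
    using image_compactin[OF _ s(1)] X(1) compact_space_def by blast
  then have clo: "closedin cantor_space ?K"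
    using compactin_imp_closedin Hausdorff_space_cantor by blast
  have "perfect_set ?K"
    unfolding perfect_set_def
  proof (intro ballI allI)
    fix y n assume "y \<in> ?K"
    then obtain x where x: "x \<in> topspace X" "y = s x" by blast
    define Z where "Z = {z \<in> topspace X. s z \<in> {u. agree n u (s x)}}"
    have "openin X Z"
      unfolding Z_def using s(1) openin_cantor_cylinder by (rule openin_continuous_map_preimage)
    then have "Z \<noteq> {x}" using perf by blast
    moreover have "x \<in> Z" using x(1) by (simp add: Z_def)
    ultimately obtain z where "z \<in> Z" and zx: "z \<noteq> x" by blast
    then have z: "z \<in> topspace X" "agree n (s z) (s x)" by (simp_all add: Z_def)
    have "s z \<noteq> y" using inj_onD[OF s(2) _ z(1) x(1)] zx x(2) by blast
    then show "\<exists>u\<in>?K. u \<noteq> y \<and> agree n u y" using z x(2) by blast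
  qed
  then have "subtopology cantor_space ?K homeomorphic_space cantor_space"
    using perfect_set_homeomorphic_cantor[OF clo] X(2) homeomorphic_map_imp_homeomorphic_space by blast
  moreover have "X homeomorphic_space subtopology cantor_space ?K"
    using continuous_imp_embedding_map[OF s(1) X(1) Hausdorff_space_cantor s(2)]
    unfolding embedding_map_def by (rule homeomorphic_map_imp_homeomorphic_space)
  ultimately show ?thesis by (rule homeomorphic_space_trans[rotated])
qed

lemma cantor_not_isolated: "\<not> openin cantor_space {x}"
proof
  assume "openin cantor_space {x}"
  then obtain n where n: "\<And>y. agree n y x \<Longrightarrow> y \<in> {x}"
    using cantor_open_contains_cylinder[of "{x}" x] by blast
  have "agree n (x(n := \<not> x n)) x" by (simp add: agree_def)
  then have "x(n := \<not> x n) = x" using n by blast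
  then show False by (metis fun_upd_same)
qed

lemma homeomorphic_cantor_subspace:
  assumes X: "compact_space X" "closedin X S" "openin X S" "S \<noteq> {}"
    and s: "continuous_map X cantor_space s" "inj_on s (topspace X)"
    and perf: "\<And>x. \<not> openin X {x}"
  shows "subtopology X S homeomorphic_space cantor_space"
proof (rule homeomorphic_cantor_space)
  have S: "S \<subseteq> topspace X" using X(3) openin_subset by blast
  show "compact_space (subtopology X S)"
    using X by (meson closedin_compact_space compact_space_subtopology)
  show "topspace (subtopology X S) \<noteq> {}" using S X(4) by auto
  show "continuous_map (subtopology X S) cantor_space s"
    using s(1) by (rule continuous_map_from_subtopology)
  show "inj_on s (topspace (subtopology X S))" using s(2) by (rule inj_on_subset) auto
  show "\<not> openin (subtopology X S) {x}" for x
    using perf X(3) openin_trans_full by blast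
qed

text \<open>Interleaving the two sequences of bits.\<close>

lemma cantor_embedding_prod:
  assumes s: "continuous_map X cantor_space s" "inj_on s (topspace X)"
    and t: "continuous_map Y cantor_space t" "inj_on t (topspace Y)"
  shows "\<exists>M. continuous_map (prod_topology X Y) cantor_space M \<and>
             inj_on M (topspace (prod_topology X Y))"
proof -
  define M where "M p = (\<lambda>i. if even i then s (fst p) (i div 2) else t (snd p) (i div 2))" for p
  have "continuous_map (prod_topology X Y) cantor_space M"
    unfolding continuous_map_cantor_iff
  proof
    fix i
    have "locally_constant (prod_topology X Y) (\<lambda>p. s (fst p) (i div 2))"
      using s(1) unfolding continuous_map_cantor_iff
      by (intro locally_constant_compose[OF continuous_map_fst, of X "\<lambda>w. s w (i div 2)"]) auto
    moreover have "locally_constant (prod_topology X Y) (\<lambda>p. t (snd p) (i div 2))"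
      using t(1) unfolding continuous_map_cantor_iff
      by (intro locally_constant_compose[OF continuous_map_snd, of Y "\<lambda>w. t w (i div 2)"]) auto
    ultimately show "locally_constant (prod_topology X Y) (\<lambda>p. M p i)"
      by (cases "even i") (simp_all add: M_def)
  qed
  moreover have "inj_on M (topspace (prod_topology X Y))"
  proof (rule inj_onI)
    fix p q assume pq: "p \<in> topspace (prod_topology X Y)" "q \<in> topspace (prod_topology X Y)"
      and eq: "M p = M q"
    have "s (fst p) i = s (fst q) i" for i using fun_cong[OF eq, of "2 * i"] by (simp add: M_def)
    then have "s (fst p) = s (fst q)" by blast
    then have "fst p = fst q" using s(2) pq by (auto dest: inj_onD)
    moreover have "t (snd p) i = t (snd q) i" for i
      using fun_cong[OF eq, of "2 * i + 1"] by (simp add: M_def)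
    then have "t (snd p) = t (snd q)" by blast
    then have "snd p = snd q" using t(2) pq by (auto dest: inj_onD)
    ultimately show "p = q" by (simp add: prod_eq_iff)
  qed
  ultimately show ?thesis by blast
qed

text \<open>The factor \<open>cantor_space\<close> removes isolated points from \<open>W\<close>. The labels \<open>a\<close> and \<open>b\<close> cut both
  spaces into clopen pieces, each of which is a Cantor space; pieces with equal label are identified
  separately and the identifications are glued.\<close>

lemma cantor_product_homeomorphism:
  assumes W: "compact_space W"
    and s: "continuous_map W cantor_space s" "inj_on s (topspace W)"
    and a: "locally_constant W a" and b: "locally_constant cantor_space b"
    and ab: "a ` topspace W = range b"
  shows "\<exists>\<phi>. homeomorphic_map cantor_space (prod_topology W cantor_space) \<phi> \<and>
             (\<forall>x. a (fst (\<phi> x)) = b x)"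
proof -
  let ?X = "prod_topology W cantor_space"
  have X: "compact_space ?X" using W compact_space_cantor by (simp add: compact_space_prod_topology)
  obtain M where M: "continuous_map ?X cantor_space M" and Minj: "inj_on M (topspace ?X)"
    using cantor_embedding_prod[OF s continuous_map_id inj_on_id] by blast
  have Xperf: "\<not> openin ?X {p}" for p
  proof
    assume "openin ?X {p}"
    then have "openin cantor_space (snd ` {p})"
      using open_map_snd unfolding open_map_def by blast
    then show False using cantor_not_isolated by simp
  qed
  have aX: "locally_constant ?X (\<lambda>p. a (fst p))"
    by (rule locally_constant_compose[OF continuous_map_fst a])
  define A where "A t = {p \<in> topspace ?X. a (fst p) = t}" for t
  define B where "B t = {x \<in> topspace cantor_space. b x = t}" for t
  have "\<exists>h. homeomorphic_map (subtopology cantor_space (B t)) (subtopology ?X (A t)) h"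
    if t: "t \<in> range b" for t
  proof -
    have "\<exists>w\<in>topspace W. a w = t" using t ab by (metis imageE)
    then have "A t \<noteq> {}" unfolding A_def by auto
    moreover have "closedin ?X (A t)" "openin ?X (A t)"
      unfolding A_def using aX
      by (rule closedin_locally_constant_Collect, rule openin_locally_constant_Collect)
    ultimately have "subtopology ?X (A t) homeomorphic_space cantor_space"
      using homeomorphic_cantor_subspace[OF X _ _ _ M Minj Xperf] by blast
    moreover have "B t \<noteq> {}" unfolding B_def using t by auto
    moreover have "closedin cantor_space (B t)" "openin cantor_space (B t)"
      unfolding B_def using b
      by (rule closedin_locally_constant_Collect, rule openin_locally_constant_Collect)
    ultimately have "subtopology cantor_space (B t) homeomorphic_space cantor_space"
      using homeomorphic_cantor_subspace[OF compact_space_cantor, of "B t" id] cantor_not_isolated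
      by auto
    with \<open>subtopology ?X (A t) homeomorphic_space cantor_space\<close>
    have "subtopology cantor_space (B t) homeomorphic_space subtopology ?X (A t)"
      by (meson homeomorphic_space_sym homeomorphic_space_trans)
    then show ?thesis by (simp add: homeomorphic_space)
  qed
  then obtain h where h: "\<And>t. t \<in> range b \<Longrightarrow>
      homeomorphic_map (subtopology cantor_space (B t)) (subtopology ?X (A t)) (h t)"
    by metis
  define \<phi> where "\<phi> x = h (b x) x" for x
  have hom: "homeomorphic_map (subtopology cantor_space (B (b x))) (subtopology ?X (A (b x))) (h (b x))"
    for x using h by blast
  have im: "h (b x) ` B (b x) = A (b x)" for x
    using homeomorphic_imp_surjective_map[OF hom] by (auto simp: A_def B_def)
  have inj: "inj_on (h (b x)) (B (b x))" for x
    using homeomorphic_imp_injective_map[OF hom[of x]] by simp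
  have \<phi>A: "\<phi> x \<in> A (b x)" for x
  proof -
    have "x \<in> B (b x)" by (simp add: B_def)
    then show ?thesis unfolding \<phi>_def using im by blast
  qed
  have a\<phi>: "a (fst (\<phi> x)) = b x" for x
    using \<phi>A[of x] unfolding A_def mem_Collect_eq by (rule conjunct2)
  have "homeomorphic_map cantor_space ?X \<phi>"
  proof (rule continuous_imp_homeomorphic_map)
    show "continuous_map cantor_space ?X \<phi>"
    proof (rule pasting_lemma[where I = "range b" and T = B and f = h])
      show "openin cantor_space (B t)" for t
        unfolding B_def using b by (rule openin_locally_constant_Collect)
      show "continuous_map (subtopology cantor_space (B t)) ?X (h t)" if "t \<in> range b" for t
        using homeomorphic_imp_continuous_map[OF h[OF that]] continuous_map_into_fulltopology by blast
    qed (auto simp: B_def \<phi>_def)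
    show "compact_space cantor_space" by (rule compact_space_cantor)
    have "Hausdorff_space W"
      using Hausdorff_space_injective_preimage[OF Hausdorff_space_cantor s] .
    then show "Hausdorff_space ?X"
      using Hausdorff_space_cantor unfolding Hausdorff_space_prod_topology by blast
    show "\<phi> ` topspace cantor_space = topspace ?X"
    proof
      have "A t \<subseteq> topspace ?X" for t unfolding A_def by (rule Collect_restrict)
      then show "\<phi> ` topspace cantor_space \<subseteq> topspace ?X" using \<phi>A by blast
      show "topspace ?X \<subseteq> \<phi> ` topspace cantor_space"
      proof
        fix p assume p: "p \<in> topspace ?X"
        then have "a (fst p) \<in> range b" using ab by auto
        then obtain x where x: "a (fst p) = b x" by blast
        then have "p \<in> h (b x) ` B (b x)" using p im by (simp add: A_def)
        then obtain y where y: "y \<in> B (b x)" "p = h (b x) y" by blast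
        then have "p = \<phi> y" by (simp add: \<phi>_def B_def)
        then show "p \<in> \<phi> ` topspace cantor_space" by simp
      qed
    qed
    show "inj_on \<phi> (topspace cantor_space)"
    proof (rule inj_onI)
      fix x y assume eq: "\<phi> x = \<phi> y"
      have "b x = b y" unfolding a\<phi>[symmetric] eq by (rule refl)
      then have "x \<in> B (b x)" "y \<in> B (b x)" "h (b x) x = h (b x) y"
        using eq by (simp_all add: \<phi>_def B_def)
      then show "x = y" using inj[of x] by (meson inj_onD)
    qed
  qed
  then show ?thesis using a\<phi> by (intro exI[of _ \<phi>] conjI allI)
qed

section \<open>Neighbourhoods in the space of actions\<close>

lemma homeo_continuous:
  "f \<in> carrier homeo_group \<Longrightarrow> continuous_map cantor_space cantor_space f"
  by (simp add: carrier_homeo_group homeomorphic_imp_continuous_map)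

lemma homeo_in_mspace:
  "f \<in> carrier homeo_group \<Longrightarrow> f \<in> mspace (cfunspace cantor_space cantor_metric)"
  using topspace_homeo_topology unfolding homeo_topology_def by auto

lemma openin_homeo_agree:
  assumes f: "f \<in> carrier homeo_group"
  shows "openin homeo_topology {h \<in> carrier homeo_group. \<forall>x. agree n (h x) (f x)}"
proof (subst openin_subopen, intro ballI)
  fix h assume "h \<in> {h \<in> carrier homeo_group. \<forall>x. agree n (h x) (f x)}"
  then have h: "h \<in> carrier homeo_group" "\<And>x. agree n (h x) (f x)" by auto
  let ?m = "cfunspace cantor_space cantor_metric"
  interpret Metric_space "mspace ?m" "mdist ?m" by (rule Metric_space_mspace_mdist)
  let ?T = "mball h ((1 / 2) ^ n) \<inter> carrier homeo_group"
  have "openin homeo_topology ?T"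
    unfolding homeo_topology_def mtopology_of_def openin_subtopology using openin_mball by blast
  moreover have "h \<in> mball h ((1 / 2) ^ n)"
    unfolding centre_in_mball_iff by (intro conjI homeo_in_mspace h(1)) simp
  then have "h \<in> ?T" using h(1) by blast
  moreover have "?T \<subseteq> {h \<in> carrier homeo_group. \<forall>x. agree n (h x) (f x)}"
  proof
    fix k assume k: "k \<in> ?T"
    then have "k \<in> mball h ((1 / 2) ^ n)" and k2: "k \<in> carrier homeo_group" by blast+
    then have k3: "mdist ?m h k \<le> (1 / 2) ^ n" unfolding in_mball by argo
    have "agree n (k x) (f x)" for x
    proof -
      have "mdist cantor_metric (h x) (k x) \<le> (1 / 2) ^ n"
        by (rule mdist_cfunspace_imp_mdist_le[OF homeo_in_mspace[OF h(1)] homeo_in_mspace[OF k2] k3])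
          simp
      then have "agree n (h x) (k x)"
        by (simp only: mdist_cantor_metric cantor_dist_le_iff agree_def simp_thms)
      then show ?thesis using h(2)[of x] agree_sym agree_trans by blast
    qed
    then show "k \<in> {h \<in> carrier homeo_group. \<forall>x. agree n (h x) (f x)}" using k2 by blast
  qed
  ultimately show "\<exists>T. openin homeo_topology T \<and> h \<in> T \<and>
      T \<subseteq> {h \<in> carrier homeo_group. \<forall>x. agree n (h x) (f x)}" by blast
qed

text \<open>Agreement of the values on the first \<open>n\<close> bits is closeness up to \<open>2\<^sup>-\<^sup>n\<close> in the uniform
  metric, so together with the previous lemma such agreements describe all neighbourhoods.\<close>

lemma homeo_topology_contains_agree:
  assumes U: "openin homeo_topology U" "f \<in> U"
  obtains n where "\<And>h. h \<in> carrier homeo_group \<Longrightarrow> (\<And>x. agree n (h x) (f x)) \<Longrightarrow> h \<in> U"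
proof -
  let ?m = "cfunspace cantor_space cantor_metric"
  interpret Metric_space "mspace ?m" "mdist ?m" by (rule Metric_space_mspace_mdist)
  have f: "f \<in> carrier homeo_group" using openin_subset[OF U(1)] U(2) topspace_homeo_topology by blast
  obtain V where V: "openin mtopology V" "U = V \<inter> carrier homeo_group"
    using U(1) unfolding homeo_topology_def mtopology_of_def openin_subtopology by blast
  have "f \<in> V" using U(2) V(2) by blast
  then obtain r where r: "r > 0" "mball f r \<subseteq> V" using V(1) unfolding openin_mtopology by blast
  obtain n where n: "(1 / 2 :: real) ^ n < r" using real_arch_pow_inv[of r "1/2"] r(1) by auto
  have "h \<in> U" if h: "h \<in> carrier homeo_group" "\<And>x. agree n (h x) (f x)" for h
  proof -
    have "mdist ?m f h \<le> (1 / 2) ^ n"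
    proof (rule mdist_cfunspace_le)
      show "mdist cantor_metric (f x) (h x) \<le> (1 / 2) ^ n" for x
        using agree_sym[OF h(2)[of x]]
        by (simp only: mdist_cantor_metric cantor_dist_le_iff agree_def simp_thms)
    qed simp
    then have "mdist ?m f h < r" using n by simp
    then have "h \<in> mball f r"
      unfolding in_mball by (intro conjI homeo_in_mspace f h(1))
    then show ?thesis using r(2) V(2) h(1) by blast
  qed
  then show ?thesis by (rule that)
qed

text \<open>A basic neighbourhood of \<open>\<alpha>\<close>: the actions of finitely many elements are prescribed up to the
  pieces of a clopen partition, which is given by the locally constant function \<open>P\<close>.\<close>

definition action_nbhd ::
  "('g, 'm) monoid_scheme \<Rightarrow> ('g \<Rightarrow> (nat \<Rightarrow> bool) \<Rightarrow> (nat \<Rightarrow> bool)) \<Rightarrow> 'g set \<Rightarrow>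
   ((nat \<Rightarrow> bool) \<Rightarrow> 'b) \<Rightarrow> ('g \<Rightarrow> (nat \<Rightarrow> bool) \<Rightarrow> (nat \<Rightarrow> bool)) set" where
  "action_nbhd G \<alpha> F P = {\<beta> \<in> actions G. \<forall>f\<in>F. \<forall>x. P (\<beta> f x) = P (\<alpha> f x)}"

lemma action_homeo:
  "\<alpha> \<in> actions G \<Longrightarrow> g \<in> carrier G \<Longrightarrow> \<alpha> g \<in> carrier homeo_group"
  by (auto simp: actions_def hom_def)

lemma action_continuous:
  "\<alpha> \<in> actions G \<Longrightarrow> g \<in> carrier G \<Longrightarrow> continuous_map cantor_space cantor_space (\<alpha> g)"
  by (simp add: action_homeo homeo_continuous)

lemma openin_action_coordinate:
  assumes "openin homeo_topology U" "f \<in> carrier G"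
  shows "openin (action_topology G) {\<beta> \<in> actions G. \<beta> f \<in> U}"
proof -
  have "continuous_map (action_topology G) homeo_topology (\<lambda>\<beta>. \<beta> f)"
    unfolding action_topology_def
    by (rule continuous_map_from_subtopology[OF continuous_map_product_projection[OF assms(2)]])
  from openin_continuous_map_preimage[OF this assms(1)] show ?thesis
    by (simp add: topspace_action_topology)
qed

lemma action_nbhd_interior:
  assumes \<alpha>: "\<alpha> \<in> actions G" and F: "finite F" "F \<subseteq> carrier G" and P: "locally_constant cantor_space P"
  obtains U where "openin (action_topology G) U" "\<alpha> \<in> U" "U \<subseteq> action_nbhd G \<alpha> F P"
proof -
  obtain n where n: "\<And>x y. agree n x y \<Longrightarrow> P x = P y"
    using P unfolding locally_constant_cantor_iff by blast
  define V where "V f = {h \<in> carrier homeo_group. \<forall>x. agree n (h x) (\<alpha> f x)}" for f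
  define U where "U = actions G \<inter> (\<Inter>f\<in>F. {\<beta> \<in> actions G. \<beta> f \<in> V f})"
  have "openin (action_topology G) {\<beta> \<in> actions G. \<beta> f \<in> V f}" if "f \<in> F" for f
    unfolding V_def using that F \<alpha> by (intro openin_action_coordinate openin_homeo_agree action_homeo) auto
  then have "openin (action_topology G) (topspace (action_topology G) \<inter> (\<Inter>f\<in>F. {\<beta> \<in> actions G. \<beta> f \<in> V f}))"
    using F(1) by (intro openin_Int_Inter) auto
  then have "openin (action_topology G) U" unfolding U_def topspace_action_topology .
  moreover have "\<alpha> \<in> U" using \<alpha> F(2) by (auto simp: U_def V_def action_homeo)
  moreover have "U \<subseteq> action_nbhd G \<alpha> F P"
    unfolding U_def V_def action_nbhd_def using n by blast
  ultimately show ?thesis by (rule that)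
qed

lemma action_topology_contains_nbhd:
  assumes U: "openin (action_topology G) U" "\<alpha> \<in> U"
  obtains F n where "finite F" "F \<subseteq> carrier G"
    "\<And>\<beta>. \<beta> \<in> actions G \<Longrightarrow> (\<And>f x. f \<in> F \<Longrightarrow> agree n (\<beta> f x) (\<alpha> f x)) \<Longrightarrow> \<beta> \<in> U"
proof -
  obtain O' where O: "openin (product_topology (\<lambda>_. homeo_topology) (carrier G)) O'" "U = O' \<inter> actions G"
    using U(1) unfolding action_topology_def openin_subtopology by blast
  have \<alpha>: "\<alpha> \<in> O'" "\<alpha> \<in> actions G" using U(2) O(2) by auto
  obtain V where V: "finite {i \<in> carrier G. V i \<noteq> topspace homeo_topology}"
     "\<forall>i\<in>carrier G. openin homeo_topology (V i)" "\<alpha> \<in> Pi\<^sub>E (carrier G) V" "Pi\<^sub>E (carrier G) V \<subseteq> O'"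
    using O(1)[unfolded openin_product_topology_alt, THEN bspec, OF \<alpha>(1)] by (elim exE conjE)
  define F where "F = {i \<in> carrier G. V i \<noteq> topspace homeo_topology}"
  have "\<exists>n. \<forall>h. h \<in> carrier homeo_group \<longrightarrow> (\<forall>x. agree n (h x) (\<alpha> f x)) \<longrightarrow> h \<in> V f" if "f \<in> F" for f
  proof -
    have "openin homeo_topology (V f)" "\<alpha> f \<in> V f"
      using that V(2,3) by (auto simp: F_def)
    then obtain n where "\<And>h. h \<in> carrier homeo_group \<Longrightarrow> (\<And>x. agree n (h x) (\<alpha> f x)) \<Longrightarrow> h \<in> V f"
      by (rule homeo_topology_contains_agree) blast
    then show ?thesis by blast
  qed
  then obtain N where N: "\<And>f h. f \<in> F \<Longrightarrow> h \<in> carrier homeo_group \<Longrightarrow>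
     (\<forall>x. agree (N f) (h x) (\<alpha> f x)) \<Longrightarrow> h \<in> V f" by metis
  have finF: "finite F" using V(1) by (simp add: F_def)
  then obtain n where n: "\<And>f. f \<in> F \<Longrightarrow> N f \<le> n"
    using finite_imageI[OF finF, of N] unfolding finite_nat_set_iff_bounded_le by blast
  have "\<beta> \<in> U" if \<beta>: "\<beta> \<in> actions G" and ag: "\<And>f x. f \<in> F \<Longrightarrow> agree n (\<beta> f x) (\<alpha> f x)" for \<beta>
  proof -
    have "\<beta> f \<in> V f" if f: "f \<in> carrier G" for f
    proof (cases "f \<in> F")
      case True
      then show ?thesis using N[OF True] action_homeo[OF \<beta> f] agree_mono[OF ag[OF True] n[OF True]] by blast
    next
      case False
      then have "V f = topspace homeo_topology" using f by (simp add: F_def)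
      then show ?thesis using action_homeo[OF \<beta> f] topspace_homeo_topology by blast
    qed
    moreover have "\<beta> \<in> extensional (carrier G)" using \<beta> by (simp add: actions_def)
    ultimately have "\<beta> \<in> Pi\<^sub>E (carrier G) V" by (auto simp: PiE_def)
    then show ?thesis using V(4) O(2) \<beta> by blast
  qed
  moreover have "F \<subseteq> carrier G" by (auto simp: F_def)
  ultimately show ?thesis using finF that by blast
qed

section \<open>Realising zero-dimensional systems near a given action\<close>

lemma action_mult:
  "\<alpha> \<in> actions G \<Longrightarrow> g \<in> carrier G \<Longrightarrow> h \<in> carrier G \<Longrightarrow> \<alpha> (g \<otimes>\<^bsub>G\<^esub> h) x = \<alpha> g (\<alpha> h x)"
  by (simp add: actions_def hom_def mult_homeo_group)

lemma (in group) action_one: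
  assumes "\<alpha> \<in> actions G"
  shows "\<alpha> \<one> x = x"
proof -
  have "\<alpha> \<one> = \<one>\<^bsub>homeo_group\<^esub>"
    using assms by (intro hom_one[OF _ is_group group_homeo_group]) (simp add: actions_def)
  then show ?thesis by (simp add: one_homeo_group)
qed

lemma (in group) actionsI:
  assumes cont: "\<And>g. g \<in> carrier G \<Longrightarrow> continuous_map cantor_space cantor_space (\<gamma> g)"
    and one: "\<And>x. \<gamma> \<one> x = x"
    and mult: "\<And>g h x. g \<in> carrier G \<Longrightarrow> h \<in> carrier G \<Longrightarrow> \<gamma> (g \<otimes> h) x = \<gamma> g (\<gamma> h x)"
  shows "restrict \<gamma> (carrier G) \<in> actions G"
proof -
  have inv: "\<gamma> (inv g) (\<gamma> g x) = x" "\<gamma> g (\<gamma> (inv g) x) = x" if "g \<in> carrier G" for g x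
    using mult[of "inv g" g x] mult[of g "inv g" x] that by (simp_all add: one)
  have "\<gamma> g \<in> carrier homeo_group" if g: "g \<in> carrier G" for g
  proof -
    have "homeomorphic_maps cantor_space cantor_space (\<gamma> g) (\<gamma> (inv g))"
      unfolding homeomorphic_maps_def using cont g inv by auto
    then show ?thesis unfolding carrier_homeo_group homeomorphic_map_maps by blast
  qed
  moreover have "\<gamma> (g \<otimes> h) = \<gamma> g \<circ> \<gamma> h" if "g \<in> carrier G" "h \<in> carrier G" for g h
    using mult[OF that] by (simp add: fun_eq_iff[of _ "\<gamma> g \<circ> \<gamma> h"])
  ultimately have "restrict \<gamma> (carrier G) \<in> hom G homeo_group"
    by (intro homI) (simp_all add: mult_homeo_group)
  then show ?thesis by (simp add: actions_def)
qed

text \<open>Transport the action \<open>\<gamma> \<times> id\<close> on \<open>W\<close> times the Cantor space along a homeomorphism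
  \<open>\<phi>\<close> that sends every point \<open>x\<close> to a point over some \<open>w\<close> with the same pattern:
  \<open>l (\<gamma> f w) = S (\<alpha> f x)\<close> for all \<open>f\<close> in \<open>F\<close>. Then \<open>S\<close> cannot tell the new action of \<open>f\<close> from the
  old one, and \<open>q = fst \<circ> \<phi>\<close> is a factor map onto \<open>W\<close>.\<close>

lemma (in group) realise_system:
  fixes W :: "'w topology" and \<gamma> :: "'a \<Rightarrow> 'w \<Rightarrow> 'w"
  assumes W: "compact_space W" and s: "continuous_map W cantor_space s" "inj_on s (topspace W)"
    and \<gamma>: "\<And>g. g \<in> carrier G \<Longrightarrow> continuous_map W W (\<gamma> g)"
    and one: "\<And>w. w \<in> topspace W \<Longrightarrow> \<gamma> \<one> w = w"
    and mult: "\<And>g h w. g \<in> carrier G \<Longrightarrow> h \<in> carrier G \<Longrightarrow> w \<in> topspace W \<Longrightarrow>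
                 \<gamma> (g \<otimes> h) w = \<gamma> g (\<gamma> h w)"
    and l: "locally_constant W l"
    and \<alpha>: "\<alpha> \<in> actions G" and S: "locally_constant cantor_space S"
    and F: "finite F" "F \<subseteq> carrier G" "\<one> \<in> F"
    and pat: "(\<lambda>w. \<lambda>f\<in>F. l (\<gamma> f w)) ` topspace W = range (\<lambda>x. \<lambda>f\<in>F. S (\<alpha> f x))"
  shows "\<exists>\<beta> q. \<beta> \<in> action_nbhd G \<alpha> F S \<and> continuous_map cantor_space W q \<and>
     range q = topspace W \<and> (\<forall>g\<in>carrier G. \<forall>x. q (\<beta> g x) = \<gamma> g (q x)) \<and> (\<forall>x. l (q x) = S x)"
proof -
  let ?X = "prod_topology W cantor_space"
  let ?a = "\<lambda>w. \<lambda>f\<in>F. l (\<gamma> f w)" and ?b = "\<lambda>x. \<lambda>f\<in>F. S (\<alpha> f x)"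
  have la: "locally_constant W ?a"
    using F by (intro locally_constant_restrict locally_constant_compose[OF \<gamma> l]) auto
  have lb: "locally_constant cantor_space ?b"
    using F by (intro locally_constant_restrict locally_constant_compose[OF action_continuous[OF \<alpha>] S]) auto
  obtain \<phi> where \<phi>: "homeomorphic_map cantor_space ?X \<phi>" and ab: "\<And>x. ?a (fst (\<phi> x)) = ?b x"
    using cantor_product_homeomorphism[OF W s la lb pat] by blast
  obtain \<psi> where "homeomorphic_maps cantor_space ?X \<phi> \<psi>"
    using \<phi> unfolding homeomorphic_map_maps by blast
  then have \<psi>: "continuous_map cantor_space ?X \<phi>" "continuous_map ?X cantor_space \<psi>"
      "\<And>x. \<psi> (\<phi> x) = x" "\<And>p. p \<in> topspace ?X \<Longrightarrow> \<phi> (\<psi> p) = p"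
    unfolding homeomorphic_maps_def by auto
  define q where "q x = fst (\<phi> x)" for x
  have q: "continuous_map cantor_space W q"
    using continuous_map_compose[OF \<psi>(1) continuous_map_fst] unfolding comp_def q_def[abs_def] .
  have qW: "q x \<in> topspace W" for x
    using continuous_map_image_subset_topspace[OF q] by (simp add: image_subset_iff)
  have \<gamma>W: "\<gamma> g w \<in> topspace W" if "g \<in> carrier G" "w \<in> topspace W" for g w
    using continuous_map_image_subset_topspace[OF \<gamma>[OF that(1)]] that(2) by blast
  define \<theta> where "\<theta> g x = \<psi> (\<gamma> g (q x), snd (\<phi> x))" for g x
  have \<phi>\<theta>: "\<phi> (\<theta> g x) = (\<gamma> g (q x), snd (\<phi> x))" if "g \<in> carrier G" for g x
    unfolding \<theta>_def using \<psi>(4) \<gamma>W[OF that qW] by simp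
  have q\<theta>: "q (\<theta> g x) = \<gamma> g (q x)" if "g \<in> carrier G" for g x
    unfolding q_def[of "\<theta> g x"] using \<phi>\<theta>[OF that] by simp
  define \<beta> where "\<beta> = restrict \<theta> (carrier G)"
  have "\<beta> \<in> actions G"
    unfolding \<beta>_def
  proof (rule actionsI)
    show "continuous_map cantor_space cantor_space (\<theta> g)" if "g \<in> carrier G" for g
    proof -
      have "continuous_map cantor_space ?X (\<lambda>x. (\<gamma> g (q x), snd (\<phi> x)))"
        using continuous_map_compose[OF q \<gamma>[OF that]] continuous_map_compose[OF \<psi>(1) continuous_map_snd]
        by (simp add: continuous_map_pairwise comp_def)
      from continuous_map_compose[OF this \<psi>(2)] show ?thesis unfolding comp_def \<theta>_def[abs_def] .
    qed
    show "\<theta> \<one> x = x" for x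
      using one[OF qW] \<psi>(3) by (simp add: \<theta>_def q_def)
    show "\<theta> (g \<otimes> h) x = \<theta> g (\<theta> h x)" if "g \<in> carrier G" "h \<in> carrier G" for g h x
      unfolding \<theta>_def[of g] \<theta>_def[of "g \<otimes> h"] q\<theta>[OF that(2)] \<phi>\<theta>[OF that(2)]
      using mult[OF that qW] by simp
  qed
  have \<beta>q: "q (\<beta> g x) = \<gamma> g (q x)" if "g \<in> carrier G" for g x
    using q\<theta>[OF that] that by (simp add: \<beta>_def)
  have pt: "l (\<gamma> f (q x)) = S (\<alpha> f x)" if "f \<in> F" for f x
    using fun_cong[OF ab[of x], of f] that by (simp add: q_def)
  have lq: "l (q x) = S x" for x
    using pt[OF F(3), of x] one[OF qW] action_one[OF \<alpha>] by simp
  have "S (\<beta> f x) = S (\<alpha> f x)" if "f \<in> F" for f x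
  proof -
    have "S (\<beta> f x) = l (q (\<beta> f x))" by (rule lq[symmetric])
    also have "q (\<beta> f x) = \<gamma> f (q x)" using \<beta>q that F(2) by blast
    finally show ?thesis using pt[OF that] by simp
  qed
  then have "\<beta> \<in> action_nbhd G \<alpha> F S" using \<open>\<beta> \<in> actions G\<close> by (simp add: action_nbhd_def)
  moreover have "range q = topspace W"
  proof
    show "range q \<subseteq> topspace W" using qW by blast
    show "topspace W \<subseteq> range q"
    proof
      fix w assume "w \<in> topspace W"
      then have "q (\<psi> (w, undefined)) = w" using \<psi>(4)[of "(w, undefined)"] by (simp add: q_def)
      then show "w \<in> range q" by (metis rangeI)
    qed
  qed
  ultimately show ?thesis using q \<beta>q lq by (intro exI[of _ \<beta>] exI[of _ q] conjI ballI allI)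
qed

section \<open>Itineraries\<close>

text \<open>The inverse makes this map equivariant for the left shift.\<close>

definition itinerary ::
  "('g, 'm) monoid_scheme \<Rightarrow> ('g \<Rightarrow> (nat \<Rightarrow> bool) \<Rightarrow> (nat \<Rightarrow> bool)) \<Rightarrow> ((nat \<Rightarrow> bool) \<Rightarrow> 'b) \<Rightarrow>
   (nat \<Rightarrow> bool) \<Rightarrow> 'g \<Rightarrow> 'b" where
  "itinerary G \<alpha> P x = (\<lambda>g\<in>carrier G. P (\<alpha> (inv\<^bsub>G\<^esub> g) x))"

abbreviation itineraries ::
  "('g, 'm) monoid_scheme \<Rightarrow> ('g \<Rightarrow> (nat \<Rightarrow> bool) \<Rightarrow> (nat \<Rightarrow> bool)) \<Rightarrow> ((nat \<Rightarrow> bool) \<Rightarrow> 'b) \<Rightarrow>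
   ('g \<Rightarrow> 'b) set" where
  "itineraries G \<alpha> P \<equiv> range (itinerary G \<alpha> P)"

definition patterns :: "'g set \<Rightarrow> ('g \<Rightarrow> 'b) set \<Rightarrow> ('g \<Rightarrow> 'b) set" where
  "patterns F Z = (\<lambda>z. restrict z F) ` Z"

definition recode :: "('g, 'm) monoid_scheme \<Rightarrow> ('b \<Rightarrow> 'c) \<Rightarrow> ('g \<Rightarrow> 'b) \<Rightarrow> ('g \<Rightarrow> 'c)" where
  "recode G h z = (\<lambda>g\<in>carrier G. h (z g))"

lemma itinerary_apply: "g \<in> carrier G \<Longrightarrow> itinerary G \<alpha> P x g = P (\<alpha> (inv\<^bsub>G\<^esub> g) x)"
  by (simp add: itinerary_def)

lemma itinerary_comp: "itinerary G \<alpha> (\<lambda>x. h (P x)) x = recode G h (itinerary G \<alpha> P x)"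
  by (auto simp: itinerary_def recode_def)

lemma itineraries_comp: "itineraries G \<alpha> (\<lambda>x. h (P x)) = recode G h ` itineraries G \<alpha> P"
  by (simp add: itinerary_comp image_image)

lemma patterns_cong_subset:
  fixes Z Y :: "('a \<Rightarrow> 'b) set"
  assumes "patterns F Z = patterns F Y" "E \<subseteq> F"
  shows "patterns E Z = patterns E Y"
proof -
  have "patterns E X = patterns E (patterns F X)" for X :: "('a \<Rightarrow> 'b) set"
  proof -
    have "restrict (restrict z F) E = restrict z E" for z :: "'a \<Rightarrow> 'b"
      using assms(2) by (simp add: Int_absorb1)
    then show ?thesis by (simp add: patterns_def image_image)
  qed
  then show ?thesis using assms(1) by metis
qed

context group
begin

lemma itinerary_one: "\<alpha> \<in> actions G \<Longrightarrow> itinerary G \<alpha> P x \<one> = P x"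
  by (simp add: itinerary_def action_one)

lemma itinerary_shift:
  assumes "\<alpha> \<in> actions G" "g \<in> carrier G"
  shows "itinerary G \<alpha> P (\<alpha> g x) = shift G g (itinerary G \<alpha> P x)"
proof
  fix h
  show "itinerary G \<alpha> P (\<alpha> g x) h = shift G g (itinerary G \<alpha> P x) h"
  proof (cases "h \<in> carrier G")
    case True
    have "inv (inv g \<otimes> h) = inv h \<otimes> g" using True assms(2) by (simp add: inv_mult_group)
    then show ?thesis
      using True assms action_mult[OF assms(1), of "inv h" g x] by (simp add: itinerary_def shift_def)
  qed (simp add: itinerary_def shift_def)
qed

lemma compact_full_shift: "finite A \<Longrightarrow> compact_space (full_shift G A)"
  by (simp add: full_shift_def compact_space_product_topology compact_space_discrete_topology)

lemma Hausdorff_full_shift: "Hausdorff_space (full_shift G A)"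
  by (simp add: full_shift_def Hausdorff_space_product_topology)

lemma locally_constant_full_shift_nth:
  assumes "g \<in> carrier G"
  shows "locally_constant (full_shift G A) (\<lambda>x. x g)"
proof -
  have "continuous_map (full_shift G A) (discrete_topology A) (\<lambda>x. x g)"
    unfolding full_shift_def by (rule continuous_map_product_projection[OF assms])
  moreover have "discrete_topology A = subtopology (discrete_topology UNIV) A" by simp
  ultimately show ?thesis by (metis continuous_map_into_fulltopology)
qed

lemma continuous_map_full_shift_iff:
  "continuous_map X (full_shift G A) f \<longleftrightarrow>
     f ` topspace X \<subseteq> extensional (carrier G) \<and>
     (\<forall>g\<in>carrier G. locally_constant X (\<lambda>x. f x g) \<and> (\<forall>x\<in>topspace X. f x g \<in> A))"
proof -
  have "continuous_map X (discrete_topology A) p \<longleftrightarrow>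
      locally_constant X p \<and> (\<forall>x\<in>topspace X. p x \<in> A)" for p :: "'c \<Rightarrow> 'd"
    using continuous_map_in_subtopology[of X "discrete_topology UNIV" A p] by auto
  then show ?thesis unfolding full_shift_def continuous_map_componentwise by simp
qed

lemma shift_continuous:
  assumes "g \<in> carrier G"
  shows "continuous_map (full_shift G A) (full_shift G A) (shift G g)"
  unfolding continuous_map_full_shift_iff
proof (intro conjI ballI)
  show "shift G g ` topspace (full_shift G A) \<subseteq> extensional (carrier G)" by (auto simp: shift_def)
  fix h assume h: "h \<in> carrier G"
  have gh: "inv g \<otimes> h \<in> carrier G" using assms h by simp
  show "locally_constant (full_shift G A) (\<lambda>x. shift G g x h)"
    using locally_constant_full_shift_nth[OF gh] h by (simp add: shift_def)
  show "shift G g x h \<in> A" if "x \<in> topspace (full_shift G A)" for x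
    using that gh h by (auto simp: shift_def full_shift_def)
qed

lemma shift_one: "x \<in> extensional (carrier G) \<Longrightarrow> shift G \<one> x = x"
  by (auto simp: shift_def extensional_def)

lemma shift_mult:
  assumes "g \<in> carrier G" "h \<in> carrier G"
  shows "shift G (g \<otimes> h) x = shift G g (shift G h x)"
  using assms by (auto simp: shift_def inv_mult_group m_assoc)

lemma itinerary_continuous:
  assumes "\<alpha> \<in> actions G" "locally_constant cantor_space P" "range P \<subseteq> A"
  shows "continuous_map cantor_space (full_shift G A) (itinerary G \<alpha> P)"
  unfolding continuous_map_full_shift_iff
proof (intro conjI ballI)
  show "itinerary G \<alpha> P ` topspace cantor_space \<subseteq> extensional (carrier G)"
    by (auto simp: itinerary_def)
  fix g assume g: "g \<in> carrier G"
  show "locally_constant cantor_space (\<lambda>x. itinerary G \<alpha> P x g)"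
    using locally_constant_compose[OF action_continuous[OF assms(1)] assms(2), of "inv g"] g
    by (simp add: itinerary_apply)
  show "itinerary G \<alpha> P x g \<in> A" for x using assms(3) g by (auto simp: itinerary_apply)
qed

lemma itineraries_subshift:
  assumes "\<alpha> \<in> actions G" "locally_constant cantor_space P" "range P \<subseteq> A"
  shows "itineraries G \<alpha> P \<in> subshifts G A"
proof -
  have "compactin (full_shift G A) (itinerary G \<alpha> P ` topspace cantor_space)"
    using image_compactin[OF _ itinerary_continuous[OF assms]] compact_space_cantor compact_space_def by blast
  then have "closedin (full_shift G A) (itineraries G \<alpha> P)"
    using compactin_imp_closedin[OF Hausdorff_full_shift] by simp
  moreover have "shift G g ` itineraries G \<alpha> P \<subseteq> itineraries G \<alpha> P" if "g \<in> carrier G" for g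
    unfolding image_image itinerary_shift[OF assms(1) that, symmetric] by blast
  ultimately show ?thesis by (simp add: subshifts_def)
qed

text \<open>A sequence is coded by the truth values of all statements \<open>x g = k\<close>.\<close>

lemma cantor_embedding_full_shift:
  fixes A :: "nat set"
  assumes "countable (carrier G)"
  shows "\<exists>s. continuous_map (full_shift G A) cantor_space s \<and> inj_on s (topspace (full_shift G A))"
proof -
  define e where "e = from_nat_into (carrier G)"
  have ne: "carrier G \<noteq> {}" using one_closed by blast
  have e: "e n \<in> carrier G" for n unfolding e_def using ne by (rule from_nat_into)
  define s where "s x i = (x (e (fst (prod_decode i))) = snd (prod_decode i))" for x :: "'a \<Rightarrow> nat" and i
  have "locally_constant (full_shift G A) (\<lambda>x. s x i)" for i
    unfolding s_def
    by (rule locally_constant_comp[where h = "\<lambda>v. v = snd (prod_decode i)"])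
      (rule locally_constant_full_shift_nth[OF e])
  then have "continuous_map (full_shift G A) cantor_space s" by (simp add: continuous_map_cantor_iff)
  moreover have "inj_on s (topspace (full_shift G A))"
  proof (rule inj_onI)
    fix x y assume xy: "x \<in> topspace (full_shift G A)" "y \<in> topspace (full_shift G A)" "s x = s y"
    have "x g = y g" if g: "g \<in> carrier G" for g
    proof -
      obtain n where n: "e n = g" using from_nat_into_surj[OF assms g] e_def by auto
      have "s x (prod_encode (n, x g)) = s y (prod_encode (n, x g))" using xy(3) by simp
      then show ?thesis by (simp add: s_def n)
    qed
    then show "x = y" using xy(1,2) by (auto simp: full_shift_def PiE_def intro: extensionalityI)
  qed
  ultimately show ?thesis by blast
qed

end

section \<open>The Vietoris topology in terms of patterns\<close>

context group
begin

lemma full_shift_open_contains_cylinder: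
  assumes "openin (full_shift G A) U" "x \<in> U"
  shows "\<exists>F. finite F \<and> F \<subseteq> carrier G \<and>
           (\<forall>y\<in>topspace (full_shift G A). restrict y F = restrict x F \<longrightarrow> y \<in> U)"
proof -
  obtain V where V: "finite {i \<in> carrier G. V i \<noteq> A}"
      "x \<in> Pi\<^sub>E (carrier G) V" "Pi\<^sub>E (carrier G) V \<subseteq> U"
    using assms(1)[unfolded full_shift_def openin_product_topology_alt topspace_discrete_topology,
        THEN bspec, OF assms(2)] by (elim exE conjE)
  let ?F = "{i \<in> carrier G. V i \<noteq> A}"
  have "y \<in> U" if y: "y \<in> topspace (full_shift G A)" "restrict y ?F = restrict x ?F" for y
  proof -
    have yE: "y \<in> carrier G \<rightarrow>\<^sub>E A" using y(1) by (simp add: full_shift_def)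
    have "y i \<in> V i" if i: "i \<in> carrier G" for i
    proof (cases "V i = A")
      case True
      then show ?thesis using PiE_mem[OF yE i] by simp
    next
      case False
      then have "y i = x i" using y(2) i unfolding restrict_eq_iff by blast
      then show ?thesis using PiE_mem[OF V(2) i] by simp
    qed
    then have "y \<in> Pi\<^sub>E (carrier G) V" using yE by (simp add: PiE_iff)
    then show ?thesis using V(3) by blast
  qed
  then show ?thesis using V(1) by (intro exI[of _ ?F]) blast
qed

lemma subshift_topspace: "X \<in> subshifts G A \<Longrightarrow> X \<subseteq> topspace (full_shift G A)"
  by (simp add: subshifts_def closedin_subset)

text \<open>The systems with a given finite set of patterns on \<open>F\<close> are those contained in the union of the
  corresponding cylinders and meeting each of them, which is a Vietoris neighbourhood.\<close>

lemma openin_same_patterns: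
  assumes A: "finite A" and X: "X \<in> subshifts G A" and F: "finite F" "F \<subseteq> carrier G"
  shows "openin (subshift_topology G A) {Y \<in> subshifts G A. patterns F Y = patterns F X}"
proof -
  let ?T = "full_shift G A" and ?p = "patterns F X"
  have lc: "locally_constant ?T (\<lambda>x. restrict x F)"
    using F locally_constant_restrict[of F ?T "\<lambda>g x. x g"] locally_constant_full_shift_nth by blast
  have "?p \<subseteq> (\<lambda>x. restrict x F) ` topspace ?T"
    unfolding patterns_def using subshift_topspace[OF X] by blast
  then have finp: "finite ?p"
    using finite_locally_constant_image[OF lc compact_full_shift[OF A]] finite_subset by blast
  define U where "U q = {x \<in> topspace ?T. restrict x F = q}" for q
  have U: "openin ?T (U q)" for q
    unfolding U_def using openin_locally_constant_Collect[OF lc, of "\<lambda>v. v = q"] by simp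
  define S where "S = {K. closedin ?T K \<and> K \<noteq> {} \<and> K \<subseteq> (\<Union>q\<in>?p. U q)}"
  define T where "T q = {K. closedin ?T K \<and> K \<inter> U q \<noteq> {}}" for q
  have "openin (vietoris_topology ?T) S"
    unfolding vietoris_topology_def S_def
    by (rule topology_generated_by_Basis, rule UnI1, rule CollectI, rule exI[of _ "\<Union>q\<in>?p. U q"])
      (use U in auto)
  moreover have "openin (vietoris_topology ?T) (T q)" for q
    unfolding vietoris_topology_def T_def
    by (rule topology_generated_by_Basis, rule UnI2, rule CollectI, rule exI[of _ "U q"])
      (use U in auto)
  ultimately have "openin (vietoris_topology ?T) (S \<inter> (\<Inter>q\<in>?p. T q))"
    using finp by (intro openin_Int_Inter) auto
  then have "openin (subshift_topology G A) ((S \<inter> (\<Inter>q\<in>?p. T q)) \<inter> subshifts G A)"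
    unfolding subshift_topology_def openin_subtopology by blast
  moreover have "(S \<inter> (\<Inter>q\<in>?p. T q)) \<inter> subshifts G A = {Y \<in> subshifts G A. patterns F Y = ?p}"
  proof -
    have "Y \<in> S \<inter> (\<Inter>q\<in>?p. T q) \<longleftrightarrow> patterns F Y = ?p" if Y: "Y \<in> subshifts G A" for Y
    proof -
      have cl: "closedin ?T Y" "Y \<noteq> {}" using Y by (auto simp: subshifts_def)
      have "Y \<in> S \<longleftrightarrow> patterns F Y \<subseteq> ?p"
        unfolding S_def U_def patterns_def[of F Y] using cl subshift_topspace[OF Y] by blast
      moreover have "Y \<in> T q \<longleftrightarrow> q \<in> patterns F Y" for q
        unfolding T_def U_def patterns_def using cl subshift_topspace[OF Y] by blast
      ultimately show ?thesis by blast
    qed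
    then show ?thesis by blast
  qed
  ultimately show ?thesis by simp
qed

text \<open>Conversely, patterns on finite windows describe all Vietoris neighbourhoods. It suffices to treat
  a subbasis. For sets of the form \<open>K \<subseteq> U\<close>, a compact \<open>X \<subseteq> U\<close> is covered by finitely many cylinders
  inside \<open>U\<close>, and the union of their windows works; for \<open>K \<inter> U \<noteq> {}\<close>, one cylinder is enough.\<close>

lemma vietoris_open_contains_patterns:
  assumes A: "finite A" and "generate_topology_on
     ({{K. closedin (full_shift G A) K \<and> K \<noteq> {} \<and> K \<subseteq> U} | U. openin (full_shift G A) U} \<union>
      {{K. closedin (full_shift G A) K \<and> K \<inter> U \<noteq> {}} | U. openin (full_shift G A) U}) W"
    and "X \<in> W" "X \<in> subshifts G A"
  shows "\<exists>F. finite F \<and> F \<subseteq> carrier G \<and>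
     (\<forall>Y\<in>subshifts G A. patterns F Y = patterns F X \<longrightarrow> Y \<in> W)"
  using assms(2,3)
proof (induction W rule: generate_topology_on.induct)
  case (Int V W)
  obtain E F where "finite E" "E \<subseteq> carrier G" "finite F" "F \<subseteq> carrier G"
    and E: "\<forall>Y\<in>subshifts G A. patterns E Y = patterns E X \<longrightarrow> Y \<in> V"
    and F: "\<forall>Y\<in>subshifts G A. patterns F Y = patterns F X \<longrightarrow> Y \<in> W"
    using Int by blast
  moreover have "Y \<in> V \<inter> W" if "Y \<in> subshifts G A" "patterns (E \<union> F) Y = patterns (E \<union> F) X" for Y
    using E F that patterns_cong_subset[OF that(2), of E] patterns_cong_subset[OF that(2), of F] by blast
  ultimately show ?case by (intro exI[of _ "E \<union> F"]) blast
next
  case (UN K)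
  then show ?case by (meson UnionE UnionI)
next
  case (Basis W)
  let ?T = "full_shift G A"
  have XT: "X \<subseteq> topspace ?T" using subshift_topspace assms(4) by blast
  consider (sub) U where "openin ?T U" "W = {K. closedin ?T K \<and> K \<noteq> {} \<and> K \<subseteq> U}"
    | (hit) U where "openin ?T U" "W = {K. closedin ?T K \<and> K \<inter> U \<noteq> {}}"
    using Basis.hyps by blast
  then show ?case
  proof cases
    case sub
    have "X \<subseteq> U" using Basis.prems sub(2) by blast
    then have "\<forall>x\<in>X. \<exists>F. finite F \<and> F \<subseteq> carrier G \<and>
           (\<forall>y\<in>topspace ?T. restrict y F = restrict x F \<longrightarrow> y \<in> U)"
      using full_shift_open_contains_cylinder[OF sub(1)] by blast
    then obtain E where E: "\<And>x. x \<in> X \<Longrightarrow> finite (E x) \<and> E x \<subseteq> carrier G"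
      "\<And>x y. x \<in> X \<Longrightarrow> y \<in> topspace ?T \<Longrightarrow> restrict y (E x) = restrict x (E x) \<Longrightarrow> y \<in> U"
      by metis
    define C where "C x = {y \<in> topspace ?T. restrict y (E x) = restrict x (E x)}" for x
    have "openin ?T (C x)" if x: "x \<in> X" for x
    proof -
      have lc: "locally_constant ?T (\<lambda>y. restrict y (E x))"
        using E(1)[OF x] locally_constant_restrict[of "E x" ?T "\<lambda>g x. x g"]
          locally_constant_full_shift_nth by blast
      show ?thesis
        unfolding C_def using openin_locally_constant_Collect[OF lc, of "\<lambda>v. v = restrict x (E x)"] .
    qed
    moreover have "X \<subseteq> \<Union>(C ` X)" using XT by (auto simp: C_def)
    moreover have "compactin ?T X"
      using closedin_compact_space[OF compact_full_shift[OF A]] assms(4) by (simp add: subshifts_def)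
    ultimately obtain \<F> where \<F>: "finite \<F>" "\<F> \<subseteq> C ` X" "X \<subseteq> \<Union>\<F>"
      unfolding compactin_def by (metis (no_types, lifting) imageE)
    obtain S where S: "S \<subseteq> X" "finite S" "\<F> = C ` S" using finite_subset_image[OF \<F>(1,2)] by blast
    let ?F = "\<Union>(E ` S)"
    have "Y \<in> W" if Y: "Y \<in> subshifts G A" "patterns ?F Y = patterns ?F X" for Y
    proof -
      have "y \<in> U" if y: "y \<in> Y" for y
      proof -
        have "restrict y ?F \<in> patterns ?F X" using y Y(2) unfolding patterns_def by blast
        then obtain x' where x': "x' \<in> X" "restrict y ?F = restrict x' ?F" unfolding patterns_def by blast
        then obtain x where x: "x \<in> S" "x' \<in> C x" using \<F>(3) S(3) by blast
        have "restrict y (E x) = restrict x' (E x)" using x'(2) x(1) unfolding restrict_eq_iff by blast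
        also have "\<dots> = restrict x (E x)" using x(2) by (simp add: C_def)
        finally show ?thesis using E(2)[of x y] x(1) S(1) y subshift_topspace[OF Y(1)] by blast
      qed
      then show ?thesis using Y(1) sub(2) by (auto simp: subshifts_def)
    qed
    moreover have "finite ?F" "?F \<subseteq> carrier G" using S E(1) by auto
    ultimately show ?thesis by blast
  next
    case hit
    then obtain x where x: "x \<in> X" "x \<in> U" using Basis.prems by blast
    obtain F where F: "finite F" "F \<subseteq> carrier G"
      "\<forall>y\<in>topspace ?T. restrict y F = restrict x F \<longrightarrow> y \<in> U"
      using full_shift_open_contains_cylinder[OF hit(1) x(2)] by blast
    have "Y \<in> W" if Y: "Y \<in> subshifts G A" "patterns F Y = patterns F X" for Y
    proof -
      have "restrict x F \<in> patterns F Y" using x(1) Y(2) unfolding patterns_def by blast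
      then obtain y where y: "y \<in> Y" "restrict y F = restrict x F" unfolding patterns_def by force
      then have "y \<in> U" using F(3) subshift_topspace[OF Y(1)] by blast
      then show ?thesis using Y(1) y(1) hit(2) by (auto simp: subshifts_def)
    qed
    then show ?thesis using F by blast
  qed
qed auto

lemma isolated_subshift_patterns:
  assumes A: "finite A" and X: "X \<in> isolated_points (subshift_topology G A)"
  shows "\<exists>F. finite F \<and> F \<subseteq> carrier G \<and> (\<forall>Y\<in>subshifts G A. patterns F Y = patterns F X \<longrightarrow> Y = X)"
proof -
  have XS: "X \<in> subshifts G A" "openin (subshift_topology G A) {X}"
    using X by (auto simp: isolated_points_def topspace_subshift_topology)
  obtain W where W: "openin (vietoris_topology (full_shift G A)) W" "{X} = W \<inter> subshifts G A"
    using XS(2) unfolding subshift_topology_def openin_subtopology by blast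
  have "X \<in> W" using W(2) by blast
  from vietoris_open_contains_patterns[OF A openin_topology_generated_by[OF W(1)[unfolded vietoris_topology_def]] this XS(1)]
  show ?thesis using W(2) by blast
qed

end

section \<open>Isolated systems\<close>

text \<open>Only systems of itineraries are compared here, with arbitrary symbols. So the notion refers
  to no alphabet and depends on \<open>Z\<close> alone, and symbols may be renamed and merged freely.\<close>

definition determined_by_patterns ::
  "('g, 'm) monoid_scheme \<Rightarrow> 'g set \<Rightarrow> ('g \<Rightarrow> nat) set \<Rightarrow> bool" where
  "determined_by_patterns G F Z \<longleftrightarrow>
     (\<forall>\<beta>\<in>actions G. \<forall>R. locally_constant cantor_space R \<longrightarrow>
        patterns F (itineraries G \<beta> R) = patterns F Z \<longrightarrow> itineraries G \<beta> R = Z)"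

definition isolated_system :: "('g, 'm) monoid_scheme \<Rightarrow> ('g \<Rightarrow> nat) set \<Rightarrow> bool" where
  "isolated_system G Z \<longleftrightarrow>
     (\<exists>\<alpha> R. \<alpha> \<in> actions G \<and> locally_constant cantor_space R \<and> Z = itineraries G \<alpha> R) \<and>
     (\<exists>F. finite F \<and> F \<subseteq> carrier G \<and> determined_by_patterns G F Z)"

lemma determined_by_patternsD:
  "determined_by_patterns G F Z \<Longrightarrow> \<beta> \<in> actions G \<Longrightarrow> locally_constant cantor_space R \<Longrightarrow>
     patterns F (itineraries G \<beta> R) = patterns F Z \<Longrightarrow> itineraries G \<beta> R = Z"
  unfolding determined_by_patterns_def by (drule bspec, assumption, drule spec, drule mp, assumption, drule mp)

context group
begin

lemma patterns_itineraries_nbhd: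
  assumes "F \<subseteq> carrier G" "\<beta> \<in> action_nbhd G \<alpha> (m_inv G ` F) R"
  shows "patterns F (itineraries G \<beta> R) = patterns F (itineraries G \<alpha> R)"
proof -
  have "restrict (itinerary G \<beta> R x) F = restrict (itinerary G \<alpha> R x) F" for x
    using assms unfolding restrict_eq_iff action_nbhd_def by (auto simp: itinerary_def)
  then show ?thesis by (simp add: patterns_def image_image)
qed

text \<open>Nearby actions show the same patterns on a finite window, hence the same isolated system.\<close>

lemma isolated_system_nbhd:
  assumes "\<alpha> \<in> actions G" "locally_constant cantor_space R" "isolated_system G (itineraries G \<alpha> R)"
  shows "\<exists>F. finite F \<and> F \<subseteq> carrier G \<and>
     (\<forall>\<beta>\<in>action_nbhd G \<alpha> F R. itineraries G \<beta> R = itineraries G \<alpha> R)"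
proof -
  obtain F where F: "finite F" "F \<subseteq> carrier G" "determined_by_patterns G F (itineraries G \<alpha> R)"
    using assms(3) unfolding isolated_system_def by (elim exE conjE)
  have "itineraries G \<beta> R = itineraries G \<alpha> R" if \<beta>: "\<beta> \<in> action_nbhd G \<alpha> (m_inv G ` F) R" for \<beta>
  proof (rule determined_by_patternsD[OF F(3)])
    show "\<beta> \<in> actions G" using \<beta> by (simp add: action_nbhd_def)
    show "locally_constant cantor_space R" by (rule assms(2))
    show "patterns F (itineraries G \<beta> R) = patterns F (itineraries G \<alpha> R)"
      using F(2) \<beta> by (rule patterns_itineraries_nbhd)
  qed
  moreover have "finite (m_inv G ` F)" "m_inv G ` F \<subseteq> carrier G" using F by auto
  ultimately show ?thesis by (intro exI[of _ "m_inv G ` F"] conjI ballI)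
qed

text \<open>An isolated system is recovered from a window that determines it and from the finite set of its
  patterns on that window.\<close>

lemma countable_isolated_systems:
  assumes "countable (carrier G)"
  shows "countable {Z. isolated_system G Z}"
proof -
  define \<D> where "\<D> = {F. finite F \<and> F \<subseteq> carrier G}"
  define \<P> where "\<P> = (\<Union>F\<in>\<D>. F \<rightarrow>\<^sub>E (UNIV :: nat set))"
  have \<D>: "countable \<D>" unfolding \<D>_def by (rule countable_Collect_finite_subset[OF assms])
  have "countable \<P>" unfolding \<P>_def using \<D> by (auto simp: \<D>_def intro: countable_PiE)
  then have cP: "countable {S. finite S \<and> S \<subseteq> \<P>}" by (rule countable_Collect_finite_subset)
  have "\<exists>F. F \<in> \<D> \<and> patterns F Z \<in> {S. finite S \<and> S \<subseteq> \<P>} \<and>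
     (\<forall>Y. isolated_system G Y \<longrightarrow> patterns F Y = patterns F Z \<longrightarrow> Y = Z)"
    if Z: "isolated_system G Z" for Z
  proof -
    obtain F where F: "finite F" "F \<subseteq> carrier G" "determined_by_patterns G F Z"
      using Z unfolding isolated_system_def by (elim exE conjE)
    obtain \<alpha> R where \<alpha>: "\<alpha> \<in> actions G" "locally_constant cantor_space R" "Z = itineraries G \<alpha> R"
      using Z unfolding isolated_system_def by (elim exE conjE)
    have "locally_constant cantor_space (\<lambda>x. \<lambda>f\<in>F. R (\<alpha> (inv f) x))"
      using F(1,2) by (intro locally_constant_restrict locally_constant_compose[OF action_continuous[OF \<alpha>(1)] \<alpha>(2)]) auto
    then have "finite (range (\<lambda>x. \<lambda>f\<in>F. R (\<alpha> (inv f) x)))"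
      using finite_locally_constant_image[OF _ compact_space_cantor] by fastforce
    moreover have "restrict (itinerary G \<alpha> R x) F = (\<lambda>f\<in>F. R (\<alpha> (inv f) x))" for x
      unfolding restrict_eq_iff using F(2) by (auto simp: itinerary_def)
    ultimately have "finite (patterns F Z)" by (simp add: patterns_def \<alpha>(3) image_image)
    moreover have "F \<in> \<D>" using F by (simp add: \<D>_def)
    moreover have "patterns F Z \<subseteq> \<P>"
    proof -
      have "patterns F Z \<subseteq> F \<rightarrow>\<^sub>E UNIV"
        unfolding patterns_def by (intro image_subsetI) (simp add: restrict_PiE_iff)
      then show ?thesis unfolding \<P>_def using \<open>F \<in> \<D>\<close> by blast
    qed
    moreover have "Y = Z" if iY: "isolated_system G Y" and pY: "patterns F Y = patterns F Z" for Y
    proof -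
      obtain \<beta> Q where "\<beta> \<in> actions G" "locally_constant cantor_space Q" and Y: "Y = itineraries G \<beta> Q"
        using iY unfolding isolated_system_def by (elim exE conjE)
      then show ?thesis using determined_by_patternsD[OF F(3)] pY unfolding Y by blast
    qed
    ultimately show ?thesis by (intro exI[of _ F]) blast
  qed
  then obtain W where W: "\<And>Z. isolated_system G Z \<Longrightarrow> W Z \<in> \<D>"
      "\<And>Z. isolated_system G Z \<Longrightarrow> patterns (W Z) Z \<in> {S. finite S \<and> S \<subseteq> \<P>}"
      "\<And>Y Z. isolated_system G Z \<Longrightarrow> isolated_system G Y \<Longrightarrow> patterns (W Z) Y = patterns (W Z) Z \<Longrightarrow> Y = Z"
    by metis
  define c where "c Z = (W Z, patterns (W Z) Z)" for Z
  have "c ` {Z. isolated_system G Z} \<subseteq> \<D> \<times> {S. finite S \<and> S \<subseteq> \<P>}"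
    unfolding c_def using W(1,2) by blast
  then have "countable (c ` {Z. isolated_system G Z})"
    by (rule countable_subset) (intro countable_SIGMA \<D> cP)
  moreover have "inj_on c {Z. isolated_system G Z}"
  proof (rule inj_onI)
    fix Y Z
    assume Y: "Y \<in> {Z. isolated_system G Z}" and Z: "Z \<in> {Z. isolated_system G Z}" and eq: "c Y = c Z"
    have W_eq: "W Y = W Z" using eq unfolding c_def prod.inject by (rule conjunct1)
    have "patterns (W Y) Y = patterns (W Z) Z" using eq unfolding c_def prod.inject by (rule conjunct2)
    then have "patterns (W Z) Y = patterns (W Z) Z" unfolding W_eq .
    then show "Y = Z" using W(3) Y Z unfolding mem_Collect_eq by blast
  qed
  ultimately show ?thesis by (rule countable_image_inj_on)
qed

end

section \<open>Density of the generic requirements\<close>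

text \<open>Refinements of a label are always of the form \<open>prod_encode (P x, T x)\<close>, so that one fixed map
  recovers the coarse label from the fine one and need not be quantified over.\<close>

definition base_label :: "nat \<Rightarrow> nat" where
  "base_label k = fst (prod_decode k)"

text \<open>Labels reading bit \<open>n\<close> for larger and larger \<open>n\<close> separate the points of the Cantor space.\<close>

definition reads_bit :: "nat \<Rightarrow> ((nat \<Rightarrow> bool) \<Rightarrow> 'b) \<Rightarrow> bool" where
  "reads_bit n R \<longleftrightarrow> (\<exists>h. \<forall>x. h (R x) = x n)"

lemma agree_iff_map: "map x [0..<m] = map y [0..<m] \<longleftrightarrow> agree m x y"
  by (auto simp: agree_def)

lemma locally_constant_map: "locally_constant cantor_space (\<lambda>x. map x [0..<m])"
  unfolding locally_constant_cantor_iff using agree_iff_map by blast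

context group
begin

lemma subshift_embedding:
  fixes A :: "nat set"
  assumes "countable (carrier G)"
  shows "\<exists>s. continuous_map (subtopology (full_shift G A) X) cantor_space s \<and>
             inj_on s (topspace (subtopology (full_shift G A) X))"
proof -
  obtain s where "continuous_map (full_shift G A) cantor_space s" "inj_on s (topspace (full_shift G A))"
    using cantor_embedding_full_shift[OF assms] by blast
  then show ?thesis
    by (intro exI[of _ s]) (auto simp: continuous_map_from_subtopology intro: inj_on_subset)
qed

text \<open>The subshift \<open>X\<close> is itself the system \<open>W\<close> to be realised, with the symbol at the identity as
  label. Since the factor map \<open>q\<close> matches this label with \<open>S\<close>, it is the itinerary map of \<open>S\<close>.\<close>

lemma realise_subshift:
  fixes S :: "(nat \<Rightarrow> bool) \<Rightarrow> nat"
  assumes cG: "countable (carrier G)" and A: "finite A" and X: "X \<in> subshifts G A"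
    and \<alpha>: "\<alpha> \<in> actions G" and S: "locally_constant cantor_space S"
    and F: "finite F" "F \<subseteq> carrier G" "\<one> \<in> F"
    and pat: "patterns (m_inv G ` F) X = patterns (m_inv G ` F) (itineraries G \<alpha> S)"
  shows "\<exists>\<beta>\<in>action_nbhd G \<alpha> F S. itineraries G \<beta> S = X"
proof -
  let ?T = "full_shift G A" and ?W = "subtopology (full_shift G A) X"
  have XT: "X \<subseteq> topspace ?T" using X by (rule subshift_topspace)
  then have topW: "topspace ?W = X" by auto
  have W: "compact_space ?W"
    using X closedin_compact_space[OF compact_full_shift[OF A]] compact_space_subtopology
    by (auto simp: subshifts_def)
  obtain s where s: "continuous_map ?W cantor_space s" "inj_on s (topspace ?W)"
    using subshift_embedding[OF cG] by blast
  have \<gamma>: "continuous_map ?W ?W (shift G g)" if g: "g \<in> carrier G" for g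
    unfolding continuous_map_in_subtopology
  proof
    show "continuous_map ?W ?T (shift G g)"
      by (rule continuous_map_from_subtopology[OF shift_continuous[OF g]])
    show "shift G g \<in> topspace ?W \<rightarrow> X" using X g unfolding topW subshifts_def by blast
  qed
  have ext: "x \<in> extensional (carrier G)" if "x \<in> X" for x
    using XT that by (auto simp: full_shift_def PiE_def)
  have l: "locally_constant ?W (\<lambda>x. x \<one>)"
    by (rule continuous_map_from_subtopology[OF locally_constant_full_shift_nth[OF one_closed]])
  have "(\<lambda>w. \<lambda>f\<in>F. shift G f w \<one>) ` X = (\<lambda>p. \<lambda>f\<in>F. p (inv f)) ` patterns (m_inv G ` F) X"
    unfolding patterns_def image_image
    by (intro image_cong refl restrict_ext) (use F in \<open>auto simp: shift_def\<close>)
  also have "\<dots> = (\<lambda>p. \<lambda>f\<in>F. p (inv f)) ` patterns (m_inv G ` F) (itineraries G \<alpha> S)"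
    by (simp only: pat)
  also have "\<dots> = range (\<lambda>x. \<lambda>f\<in>F. S (\<alpha> f x))"
    unfolding patterns_def image_image
    by (intro image_cong refl restrict_ext) (use F in \<open>auto simp: itinerary_def\<close>)
  finally have "(\<lambda>w. \<lambda>f\<in>F. shift G f w \<one>) ` topspace ?W = range (\<lambda>x. \<lambda>f\<in>F. S (\<alpha> f x))"
    unfolding topW .
  from realise_system[OF W s \<gamma> _ shift_mult l \<alpha> S F this]
  obtain \<beta> q where \<beta>: "\<beta> \<in> action_nbhd G \<alpha> F S" and q: "range q = X"
     "\<And>g x. g \<in> carrier G \<Longrightarrow> q (\<beta> g x) = shift G g (q x)" "\<And>x. q x \<one> = S x"
    using shift_one[OF ext] unfolding topW by blast
  have "itinerary G \<beta> S x = q x" for x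
  proof
    fix g
    show "itinerary G \<beta> S x g = q x g"
    proof (cases "g \<in> carrier G")
      case True
      have "itinerary G \<beta> S x g = shift G (inv g) (q x) \<one>"
        using True q(2)[of "inv g" x] q(3)[of "\<beta> (inv g) x"] by (simp add: itinerary_def)
      then show ?thesis using True by (simp add: shift_def)
    next
      case False
      have "q x \<in> X" using q(1) by blast
      then show ?thesis using False ext[of "q x"] by (simp add: itinerary_def extensional_def)
    qed
  qed
  then have "itineraries G \<beta> S = X" using q(1) by simp
  then show ?thesis using \<beta> by (rule bexI[of _ \<beta>])
qed

text \<open>An isolated point of the space of subshifts over \<open>A\<close> is compared only with subshifts over \<open>A\<close>.
  Adding the identity to the window forces any system with the same patterns to use only symbols
  from \<open>A\<close>.\<close>

lemma isolated_system_of_isolated_subshift: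
  assumes A: "finite A" and X: "X \<in> isolated_points (subshift_topology G A)"
    and \<beta>: "\<beta> \<in> actions G" "locally_constant cantor_space S" "X = itineraries G \<beta> S"
  shows "isolated_system G X"
proof -
  obtain F where F: "finite F" "F \<subseteq> carrier G"
      "\<And>Y. Y \<in> subshifts G A \<Longrightarrow> patterns F Y = patterns F X \<Longrightarrow> Y = X"
    using isolated_subshift_patterns[OF A X] by blast
  have XS: "X \<subseteq> topspace (full_shift G A)"
    using X subshift_topspace by (auto simp: isolated_points_def topspace_subshift_topology)
  have "determined_by_patterns G (insert \<one> F) X"
    unfolding determined_by_patterns_def
  proof (intro ballI allI impI)
    fix \<gamma> and R :: "(nat \<Rightarrow> bool) \<Rightarrow> nat"
    assume \<gamma>: "\<gamma> \<in> actions G" "locally_constant cantor_space R"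
      and eq: "patterns (insert \<one> F) (itineraries G \<gamma> R) = patterns (insert \<one> F) X"
    have "R x \<in> A" for x
    proof -
      have "restrict (itinerary G \<gamma> R x) (insert \<one> F) \<in> patterns (insert \<one> F) X"
        unfolding eq[symmetric] unfolding patterns_def by (intro imageI rangeI)
      then obtain y where y: "y \<in> X" "restrict (itinerary G \<gamma> R x) (insert \<one> F) = restrict y (insert \<one> F)"
        unfolding patterns_def by (elim imageE)
      then have "itinerary G \<gamma> R x \<one> = y \<one>" unfolding restrict_eq_iff by blast
      moreover have "y \<one> \<in> A" using y(1) XS by (auto simp: full_shift_def)
      ultimately show ?thesis using itinerary_one[OF \<gamma>(1)] by metis
    qed
    then have "itineraries G \<gamma> R \<in> subshifts G A"
      by (intro itineraries_subshift \<gamma>) blast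
    moreover have "patterns F (itineraries G \<gamma> R) = patterns F X"
      using patterns_cong_subset[OF eq] by blast
    ultimately show "itineraries G \<gamma> R = X" by (rule F(3))
  qed
  moreover have "finite (insert \<one> F)" "insert \<one> F \<subseteq> carrier G" using F by auto
  ultimately have "\<exists>F. finite F \<and> F \<subseteq> carrier G \<and> determined_by_patterns G F X"
    by (intro exI[of _ "insert \<one> F"] conjI)
  moreover have "\<exists>\<alpha> R. \<alpha> \<in> actions G \<and> locally_constant cantor_space R \<and> X = itineraries G \<alpha> R"
    by (intro exI[of _ \<beta>] exI[of _ S] conjI \<beta>)
  ultimately show ?thesis unfolding isolated_system_def by (rule conjI[rotated])
qed

text \<open>The label \<open>S\<close> combines \<open>P\<close> with sufficiently many bits, so that preserving \<open>S\<close> on a finite window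
  keeps the action inside \<open>U\<close>. The isolated subshift found near its itineraries shows the same
  patterns and is therefore realised by an action in \<open>U\<close>.\<close>

lemma dense_isolated_refinement:
  fixes P :: "(nat \<Rightarrow> bool) \<Rightarrow> nat"
  assumes cG: "countable (carrier G)"
    and dense: "\<And>A :: nat set. finite A \<Longrightarrow> 2 \<le> card A \<Longrightarrow>
           dense_in (subshift_topology G A) (isolated_points (subshift_topology G A))"
    and P: "locally_constant cantor_space P"
    and U: "openin (action_topology G) U" "\<alpha> \<in> U"
  shows "\<exists>\<beta>\<in>U. \<exists>R. locally_constant cantor_space R \<and> (\<forall>x. base_label (R x) = P x) \<and>
           reads_bit n R \<and> isolated_system G (itineraries G \<beta> R)"
proof -
  have \<alpha>: "\<alpha> \<in> actions G"
    using U openin_subset topspace_action_topology by blast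
  obtain F m where F: "finite F" "F \<subseteq> carrier G"
    "\<And>\<beta>. \<beta> \<in> actions G \<Longrightarrow> (\<And>f x. f \<in> F \<Longrightarrow> agree m (\<beta> f x) (\<alpha> f x)) \<Longrightarrow> \<beta> \<in> U"
    using action_topology_contains_nbhd[OF U] by blast
  \<comment> \<open>Enough bits for the neighbourhood \<open>U\<close> and for reading bit \<open>n\<close>.\<close>
  define N where "N = max m (Suc n)"
  define S where "S x = prod_encode (P x, to_nat (map x [0..<N]))" for x :: "nat \<Rightarrow> bool"
  have S: "locally_constant cantor_space S"
    unfolding S_def[abs_def]
    by (rule locally_constant_comp2[OF P locally_constant_map, of "\<lambda>a b. prod_encode (a, to_nat b)"])
  have SP: "base_label (S x) = P x" for x by (simp add: S_def base_label_def)
  have Sag: "agree N x y" if "S x = S y" for x y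
  proof -
    have "to_nat (map x [0..<N]) = to_nat (map y [0..<N])"
      using that unfolding S_def prod_encode_eq prod.inject by (rule conjunct2)
    then show ?thesis unfolding agree_iff_map[symmetric] by (rule injD[OF inj_to_nat])
  qed
  define h where "h k = (from_nat (snd (prod_decode k)) :: bool list) ! n" for k
  have "h (S x) = x n" for x by (simp add: h_def S_def N_def)
  then have h: "reads_bit n S" unfolding reads_bit_def by (intro exI[of _ h] allI)
  \<comment> \<open>Two extra symbols secure an alphabet with at least two elements.\<close>
  define A where "A = range S \<union> {0, 1}"
  have A: "finite A" using finite_locally_constant_image[OF S compact_space_cantor] by (simp add: A_def)
  have "card {0, 1 :: nat} \<le> card A" using A by (intro card_mono) (auto simp: A_def)
  then have "2 \<le> card A" by simp
  note dense = dense[OF A this]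
  have X0: "itineraries G \<alpha> S \<in> subshifts G A"
    by (rule itineraries_subshift[OF \<alpha> S]) (unfold A_def, rule Un_upper1)
  define E where "E = insert \<one> F"
  have E: "finite E" "E \<subseteq> carrier G" "\<one> \<in> E" using F by (auto simp: E_def)
  let ?V = "{Y \<in> subshifts G A. patterns (m_inv G ` E) Y = patterns (m_inv G ` E) (itineraries G \<alpha> S)}"
  have V: "openin (subshift_topology G A) ?V"
    using E by (intro openin_same_patterns[OF A X0]) auto
  have "itineraries G \<alpha> S \<in> (subshift_topology G A) closure_of (isolated_points (subshift_topology G A))"
    using dense X0 by (simp add: dense_in_def topspace_subshift_topology)
  moreover have "itineraries G \<alpha> S \<in> ?V" using X0 by simp
  ultimately have "\<exists>X. X \<in> isolated_points (subshift_topology G A) \<and> X \<in> ?V"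
    using V unfolding in_closure_of by (elim conjE) (drule spec, drule mp, rule conjI)
  then obtain X where X: "X \<in> isolated_points (subshift_topology G A)" "X \<in> ?V" by (elim exE conjE)
  obtain \<beta> where \<beta>: "\<beta> \<in> action_nbhd G \<alpha> E S" "itineraries G \<beta> S = X"
    using realise_subshift[OF cG A _ \<alpha> S E, of X] X(2) by blast
  have \<beta>a: "\<beta> \<in> actions G" using \<beta>(1) by (simp add: action_nbhd_def)
  have "\<beta> \<in> U"
  proof (rule F(3)[OF \<beta>a])
    fix f x assume "f \<in> F"
    then have "S (\<beta> f x) = S (\<alpha> f x)" using \<beta>(1) by (simp add: action_nbhd_def E_def)
    then have "agree N (\<beta> f x) (\<alpha> f x)" by (rule Sag)
    then show "agree m (\<beta> f x) (\<alpha> f x)" by (rule agree_mono) (simp add: N_def)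
  qed
  moreover have "isolated_system G (itineraries G \<beta> S)"
    unfolding \<beta>(2) by (rule isolated_system_of_isolated_subshift[OF A X(1) \<beta>a S \<beta>(2)[symmetric]])
  ultimately show ?thesis using S SP h by (intro bexI[of _ \<beta>] exI[of _ S] conjI allI)
qed

text \<open>The space \<open>D\<close> of pairs \<open>(c, z)\<close> with the same image in the common factor is a fibre product: it
  maps onto the Cantor space, so it shows the patterns of \<open>\<alpha>\<close>, and it maps onto \<open>Z\<close>, so the symbol of
  \<open>z\<close> at the identity is a label with system \<open>Z\<close>. Membership in \<open>D\<close> says that this label
  refines \<open>P\<close>.\<close>

lemma dense_lift:
  fixes P :: "(nat \<Rightarrow> bool) \<Rightarrow> nat"
  assumes cG: "countable (carrier G)"
    and P: "locally_constant cantor_space P"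
    and Z: "isolated_system G Z"
    and U: "openin (action_topology G) U" "\<alpha> \<in> U"
    and eq: "itineraries G \<alpha> P = recode G base_label ` Z"
  shows "\<exists>\<beta>\<in>U. \<exists>R. locally_constant cantor_space R \<and> (\<forall>x. base_label (R x) = P x) \<and>
           itineraries G \<beta> R = Z"
proof -
  have \<alpha>: "\<alpha> \<in> actions G"
    using U openin_subset topspace_action_topology by blast
  obtain F m where F: "finite F" "F \<subseteq> carrier G"
    "\<And>\<beta>. \<beta> \<in> actions G \<Longrightarrow> (\<And>f x. f \<in> F \<Longrightarrow> agree m (\<beta> f x) (\<alpha> f x)) \<Longrightarrow> \<beta> \<in> U"
    using action_topology_contains_nbhd[OF U] by blast
  define S where "S x = (P x, map x [0..<m])" for x :: "nat \<Rightarrow> bool"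
  have S: "locally_constant cantor_space S"
    unfolding S_def[abs_def] by (rule locally_constant_comp2[OF P locally_constant_map])
  define E where "E = insert \<one> F"
  have E: "finite E" "E \<subseteq> carrier G" "\<one> \<in> E" using F by (auto simp: E_def)
  obtain \<delta> Q where \<delta>: "\<delta> \<in> actions G" and Q: "locally_constant cantor_space Q"
    and ZQ: "Z = itineraries G \<delta> Q"
    using Z unfolding isolated_system_def by (elim exE conjE)
  define A where "A = range Q"
  have A: "finite A" using finite_locally_constant_image[OF Q compact_space_cantor] by (simp add: A_def)
  have ZS: "Z \<in> subshifts G A" unfolding ZQ by (rule itineraries_subshift[OF \<delta> Q]) (simp add: A_def)
  let ?T = "full_shift G A"
  have ZT: "Z \<subseteq> topspace ?T" using ZS by (rule subshift_topspace)
  have ext: "z \<in> extensional (carrier G)" if "z \<in> Z" for z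
    using ZT that by (auto simp: full_shift_def PiE_def)
  let ?X = "prod_topology cantor_space ?T"
  define D where "D = {p \<in> topspace ?X. snd p \<in> Z} \<inter>
     (\<Inter>g\<in>carrier G. {p \<in> topspace ?X. P (\<alpha> (inv g) (fst p)) = base_label (snd p g)})"
  have D_iff: "p \<in> D \<longleftrightarrow> snd p \<in> Z \<and> itinerary G \<alpha> P (fst p) = recode G base_label (snd p)" for p
  proof -
    have "itinerary G \<alpha> P (fst p) = recode G base_label (snd p) \<longleftrightarrow>
        (\<forall>g\<in>carrier G. P (\<alpha> (inv g) (fst p)) = base_label (snd p g))"
      unfolding itinerary_def recode_def restrict_eq_iff ..
    moreover have "snd p \<in> Z \<Longrightarrow> p \<in> topspace ?X" using ZT by (cases p) auto
    ultimately show ?thesis unfolding D_def by blast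
  qed
  have "closedin ?X {p \<in> topspace ?X. snd p \<in> Z}"
    using closedin_continuous_map_preimage[OF continuous_map_snd, of ?T Z cantor_space] ZS
    by (simp add: subshifts_def)
  moreover have "closedin ?X {p \<in> topspace ?X. P (\<alpha> (inv g) (fst p)) = base_label (snd p g)}"
    if g: "g \<in> carrier G" for g
  proof -
    have "locally_constant cantor_space (\<lambda>x. P (\<alpha> (inv g) x))"
      by (rule locally_constant_compose[OF action_continuous[OF \<alpha>] P]) (simp add: g)
    then have 1: "locally_constant ?X (\<lambda>p. P (\<alpha> (inv g) (fst p)))"
      by (rule locally_constant_compose[OF continuous_map_fst])
    have 2: "locally_constant ?X (\<lambda>p. snd p g)"
      by (rule locally_constant_compose[OF continuous_map_snd locally_constant_full_shift_nth[OF g]])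
    have "locally_constant ?X (\<lambda>p. P (\<alpha> (inv g) (fst p)) = base_label (snd p g))"
      by (rule locally_constant_comp2[OF 1 2, of "\<lambda>a b. a = base_label b"])
    from closedin_locally_constant_Collect[OF this, of "\<lambda>b. b"] show ?thesis .
  qed
  ultimately have D: "closedin ?X D"
    unfolding D_def by (intro closedin_Int closedin_Inter) auto
  let ?W = "subtopology ?X D"
  have topW: "topspace ?W = D" using closedin_subset[OF D] by auto
  have "compact_space ?X"
    using compact_space_cantor compact_full_shift[OF A] by (simp add: compact_space_prod_topology)
  then have W: "compact_space ?W" using D closedin_compact_space compact_space_subtopology by blast
  obtain s0 where s0: "continuous_map ?T cantor_space s0" "inj_on s0 (topspace ?T)"
    using cantor_embedding_full_shift[OF cG] by blast
  obtain s where s: "continuous_map ?X cantor_space s" "inj_on s (topspace ?X)"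
    using cantor_embedding_prod[OF continuous_map_id inj_on_id s0] by blast
  have sW: "continuous_map ?W cantor_space s" "inj_on s (topspace ?W)"
    using s closedin_subset[OF D] unfolding topW
    by (auto simp: continuous_map_from_subtopology intro: inj_on_subset)
  define \<gamma> where "\<gamma> g p = (\<alpha> g (fst p), shift G g (snd p))"
    for g and p :: "(nat \<Rightarrow> bool) \<times> ('a \<Rightarrow> nat)"
  have \<gamma>: "continuous_map ?W ?W (\<gamma> g)" if g: "g \<in> carrier G" for g
    unfolding continuous_map_in_subtopology
  proof
    have 1: "continuous_map ?X cantor_space (\<lambda>p. \<alpha> g (fst p))"
      using continuous_map_compose[OF continuous_map_fst action_continuous[OF \<alpha> g]] by (simp add: comp_def)
    have 2: "continuous_map ?X ?T (\<lambda>p. shift G g (snd p))"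
      using continuous_map_compose[OF continuous_map_snd shift_continuous[OF g]] by (simp add: comp_def)
    have "continuous_map ?X ?X (\<gamma> g)"
      unfolding \<gamma>_def[abs_def] using 1 2 by (simp add: continuous_map_pairwise comp_def)
    then show "continuous_map ?W ?X (\<gamma> g)" by (rule continuous_map_from_subtopology)
    show "\<gamma> g \<in> topspace ?W \<rightarrow> D"
    proof
      fix p assume "p \<in> topspace ?W"
      then have p: "snd p \<in> Z" "itinerary G \<alpha> P (fst p) = recode G base_label (snd p)"
        unfolding topW D_iff by auto
      have "shift G g (recode G base_label (snd p)) = recode G base_label (shift G g (snd p))"
        using g by (auto simp: shift_def recode_def)
      then have "itinerary G \<alpha> P (\<alpha> g (fst p)) = recode G base_label (shift G g (snd p))"
        unfolding itinerary_shift[OF \<alpha> g] p(2) .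
      moreover have "shift G g (snd p) \<in> Z" using p(1) ZS g by (auto simp: subshifts_def)
      ultimately show "\<gamma> g p \<in> D" unfolding D_iff by (simp add: \<gamma>_def)
    qed
  qed
  have one: "\<gamma> \<one> p = p" if "p \<in> topspace ?W" for p
    using that ext unfolding topW D_iff by (simp add: \<gamma>_def action_one[OF \<alpha>] shift_one)
  have mult: "\<gamma> (g \<otimes> h) p = \<gamma> g (\<gamma> h p)" if "g \<in> carrier G" "h \<in> carrier G" for g h p
    using that by (simp add: \<gamma>_def action_mult[OF \<alpha>] shift_mult)
  have "locally_constant ?X (\<lambda>p. S (fst p))"
    by (rule locally_constant_compose[OF continuous_map_fst S])
  then have l: "locally_constant ?W (\<lambda>p. S (fst p))" by (rule continuous_map_from_subtopology)
  have fstD: "fst ` D = UNIV"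
  proof (rule UNIV_eq_I[symmetric])
    fix c
    have "itinerary G \<alpha> P c \<in> recode G base_label ` Z" unfolding eq[symmetric] by (rule rangeI)
    then obtain z where "z \<in> Z" "itinerary G \<alpha> P c = recode G base_label z" by (rule imageE)
    then have "(c, z) \<in> D" unfolding D_iff by simp
    then show "c \<in> fst ` D" by force
  qed
  have "(\<lambda>p. \<lambda>f\<in>E. S (fst (\<gamma> f p))) ` topspace ?W = (\<lambda>c. \<lambda>f\<in>E. S (\<alpha> f c)) ` (fst ` D)"
    unfolding topW image_image by (simp add: \<gamma>_def)
  then have pat: "(\<lambda>p. \<lambda>f\<in>E. S (fst (\<gamma> f p))) ` topspace ?W = range (\<lambda>c. \<lambda>f\<in>E. S (\<alpha> f c))"
    unfolding fstD .
  obtain \<beta> q where \<beta>: "\<beta> \<in> action_nbhd G \<alpha> E S" and qc: "continuous_map cantor_space ?W q"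
    and q: "range q = D" "\<And>g x. g \<in> carrier G \<Longrightarrow> q (\<beta> g x) = \<gamma> g (q x)" "\<And>x. S (fst (q x)) = S x"
    using realise_system[OF W sW \<gamma> one mult l \<alpha> S E pat] unfolding topW by blast
  have \<beta>a: "\<beta> \<in> actions G" using \<beta> by (simp add: action_nbhd_def)
  have "\<beta> \<in> U"
  proof (rule F(3)[OF \<beta>a])
    fix f x assume "f \<in> F"
    then have "S (\<beta> f x) = S (\<alpha> f x)" using \<beta> by (simp add: action_nbhd_def E_def)
    then show "agree m (\<beta> f x) (\<alpha> f x)" unfolding S_def prod.inject agree_iff_map by (rule conjunct2)
  qed
  have qD: "q x \<in> D" for x using q(1) by blast
  define R where "R x = snd (q x) \<one>" for x
  have "continuous_map cantor_space ?X q" using qc by (rule continuous_map_into_fulltopology)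
  then have "locally_constant cantor_space (\<lambda>x. snd (q x) \<one>)"
    by (rule locally_constant_compose)
      (rule locally_constant_compose[OF continuous_map_snd locally_constant_full_shift_nth[OF one_closed]])
  then have R: "locally_constant cantor_space R" unfolding R_def[abs_def] .
  have RP: "base_label (R x) = P x" for x
  proof -
    have "itinerary G \<alpha> P (fst (q x)) \<one> = recode G base_label (snd (q x)) \<one>"
      using qD[of x] unfolding D_iff by (elim conjE) (rule fun_cong)
    then have "P (fst (q x)) = base_label (R x)"
      by (simp add: itinerary_one[OF \<alpha>] recode_def R_def)
    moreover have "P (fst (q x)) = P x" using q(3)[of x] by (simp add: S_def)
    ultimately show ?thesis by simp
  qed
  have it: "itinerary G \<beta> R x = snd (q x)" for x
  proof
    fix g
    show "itinerary G \<beta> R x g = snd (q x) g"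
    proof (cases "g \<in> carrier G")
      case True
      have "itinerary G \<beta> R x g = shift G (inv g) (snd (q x)) \<one>"
        using True q(2)[of "inv g" x] by (simp add: itinerary_def R_def \<gamma>_def)
      then show ?thesis using True by (simp add: shift_def)
    next
      case False
      have "snd (q x) \<in> Z" using qD[of x] unfolding D_iff by (rule conjunct1)
      then show ?thesis using False ext[of "snd (q x)"] by (simp add: itinerary_def extensional_def)
    qed
  qed
  have "itineraries G \<beta> R = snd ` D" unfolding it q(1)[symmetric] by (simp add: image_image)
  also have "snd ` D = Z"
  proof
    show "snd ` D \<subseteq> Z" using D_iff by blast
    show "Z \<subseteq> snd ` D"
    proof
      fix z assume z: "z \<in> Z"
      then have "recode G base_label z \<in> itineraries G \<alpha> P" unfolding eq by (rule imageI)
      then obtain c where "recode G base_label z = itinerary G \<alpha> P c" by (rule rangeE)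
      then have "(c, z) \<in> D" unfolding D_iff using z by simp
      then show "z \<in> snd ` D" by force
    qed
  qed
  finally have "itineraries G \<beta> R = Z" .
  with \<open>\<beta> \<in> U\<close> R RP show ?thesis by (intro bexI[of _ \<beta>] exI[of _ R] conjI allI)
qed

end

section \<open>Generic actions are conjugate\<close>

definition refines_to_isolated ::
  "('g, 'm) monoid_scheme \<Rightarrow> ((nat \<Rightarrow> bool) \<Rightarrow> nat) \<Rightarrow> nat \<Rightarrow>
   ('g \<Rightarrow> (nat \<Rightarrow> bool) \<Rightarrow> (nat \<Rightarrow> bool)) set" where
  "refines_to_isolated G P n = {\<alpha> \<in> actions G. \<exists>R. locally_constant cantor_space R \<and>
     (\<forall>x. base_label (R x) = P x) \<and> reads_bit n R \<and> isolated_system G (itineraries G \<alpha> R)}"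

definition lifts_to ::
  "('g, 'm) monoid_scheme \<Rightarrow> ((nat \<Rightarrow> bool) \<Rightarrow> nat) \<Rightarrow> ('g \<Rightarrow> nat) set \<Rightarrow>
   ('g \<Rightarrow> (nat \<Rightarrow> bool) \<Rightarrow> (nat \<Rightarrow> bool)) set" where
  "lifts_to G P Z = {\<alpha> \<in> actions G. itineraries G \<alpha> P = recode G base_label ` Z \<longrightarrow>
     (\<exists>R. locally_constant cantor_space R \<and> (\<forall>x. base_label (R x) = P x) \<and> itineraries G \<alpha> R = Z)}"

definition generic :: "('g, 'm) monoid_scheme \<Rightarrow> ('g \<Rightarrow> (nat \<Rightarrow> bool) \<Rightarrow> (nat \<Rightarrow> bool)) \<Rightarrow> bool" where
  "generic G \<alpha> \<longleftrightarrow> \<alpha> \<in> actions G \<and>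
     (\<forall>P n. locally_constant cantor_space P \<longrightarrow> \<alpha> \<in> refines_to_isolated G P n) \<and>
     (\<forall>P Z. locally_constant cantor_space P \<longrightarrow> isolated_system G Z \<longrightarrow>
        isolated_system G (recode G base_label ` Z) \<longrightarrow> \<alpha> \<in> lifts_to G P Z)"

definition same_isolated ::
  "('g, 'm) monoid_scheme \<Rightarrow> ('g \<Rightarrow> (nat \<Rightarrow> bool) \<Rightarrow> (nat \<Rightarrow> bool)) \<Rightarrow>
   ('g \<Rightarrow> (nat \<Rightarrow> bool) \<Rightarrow> (nat \<Rightarrow> bool)) \<Rightarrow> ((nat \<Rightarrow> bool) \<Rightarrow> nat) \<Rightarrow> ((nat \<Rightarrow> bool) \<Rightarrow> nat) \<Rightarrow> bool" where
  "same_isolated G \<alpha> \<beta> P Q \<longleftrightarrow> locally_constant cantor_space P \<and> locally_constant cantor_space Q \<and>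
     itineraries G \<alpha> P = itineraries G \<beta> Q \<and> isolated_system G (itineraries G \<alpha> P)"

lemma same_isolated_sym: "same_isolated G \<alpha> \<beta> P Q \<Longrightarrow> same_isolated G \<beta> \<alpha> Q P"
  unfolding same_isolated_def by (elim conjE) (intro conjI; simp)

text \<open>One half of a back-and-forth step: refine on the side of \<open>\<alpha>\<close>, then lift the refinement to \<open>\<beta>\<close>.\<close>

lemma same_isolated_step:
  assumes \<alpha>: "generic G \<alpha>" and \<beta>: "generic G \<beta>" and PQ: "same_isolated G \<alpha> \<beta> P Q"
  shows "\<exists>R S. same_isolated G \<alpha> \<beta> R S \<and> (\<forall>x. base_label (R x) = P x) \<and>
           (\<forall>x. base_label (S x) = Q x) \<and> reads_bit n R"
proof -
  have P: "locally_constant cantor_space P" and Q: "locally_constant cantor_space Q"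
    and eq: "itineraries G \<alpha> P = itineraries G \<beta> Q" and iso: "isolated_system G (itineraries G \<alpha> P)"
    using PQ unfolding same_isolated_def by - (elim conjE, assumption)+
  have "\<alpha> \<in> refines_to_isolated G P n"
    using \<alpha> P unfolding generic_def by (elim conjE) (drule spec, drule spec, drule mp)
  then obtain R where R: "locally_constant cantor_space R" "\<And>x. base_label (R x) = P x"
      "reads_bit n R" "isolated_system G (itineraries G \<alpha> R)"
    unfolding refines_to_isolated_def mem_Collect_eq by (elim exE conjE) blast
  let ?Z = "itineraries G \<alpha> R"
  have Z: "itineraries G \<alpha> P = recode G base_label ` ?Z"
    using itineraries_comp[of G \<alpha> base_label R] R(2) by simp
  have isoZ: "isolated_system G (recode G base_label ` ?Z)"
    using iso unfolding Z .
  have "\<forall>P Z. locally_constant cantor_space P \<longrightarrow> isolated_system G Z \<longrightarrow>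
        isolated_system G (recode G base_label ` Z) \<longrightarrow> \<beta> \<in> lifts_to G P Z"
    using \<beta> unfolding generic_def by (elim conjE)
  then have "\<beta> \<in> lifts_to G Q ?Z" using Q R(4) isoZ by metis
  moreover have "itineraries G \<beta> Q = recode G base_label ` ?Z" unfolding eq[symmetric] by (rule Z)
  ultimately have "\<exists>S. locally_constant cantor_space S \<and> (\<forall>x. base_label (S x) = Q x) \<and> itineraries G \<beta> S = ?Z"
    unfolding lifts_to_def mem_Collect_eq by (elim conjE) (drule mp)
  then obtain S where S: "locally_constant cantor_space S" "\<forall>x. base_label (S x) = Q x"
      "itineraries G \<beta> S = ?Z" by (elim exE conjE)
  have "same_isolated G \<alpha> \<beta> R S"
    unfolding same_isolated_def by (intro conjI R S S(3)[symmetric])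
  then show ?thesis
    by (intro exI[of _ R] exI[of _ S] conjI allI R(2,3) S(2)[rule_format])
qed

context group
begin

text \<open>The start of the back-and-forth construction. Constant labels have a one-point system, which is
  isolated because the symbol at the identity already determines it.\<close>

lemma same_isolated_const:
  assumes "\<alpha> \<in> actions G" "\<beta> \<in> actions G"
  shows "same_isolated G \<alpha> \<beta> (\<lambda>_. 0) (\<lambda>_. 0)"
proof -
  let ?z = "(\<lambda>g\<in>carrier G. 0) :: 'a \<Rightarrow> nat"
  have it: "itineraries G \<gamma> (\<lambda>_. 0) = {?z}" for \<gamma> by (auto simp: itinerary_def)
  have "determined_by_patterns G {\<one>} {?z}"
    unfolding determined_by_patterns_def
  proof (intro ballI allI impI)
    fix \<gamma> and R :: "(nat \<Rightarrow> bool) \<Rightarrow> nat"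
    assume \<gamma>: "\<gamma> \<in> actions G" and eq: "patterns {\<one>} (itineraries G \<gamma> R) = patterns {\<one>} {?z}"
    have "R x = 0" for x
    proof -
      have "restrict (itinerary G \<gamma> R x) {\<one>} \<in> patterns {\<one>} {?z}"
        unfolding eq[symmetric] unfolding patterns_def by (intro imageI rangeI)
      then have "restrict (itinerary G \<gamma> R x) {\<one>} = restrict ?z {\<one>}"
        unfolding patterns_def by simp
      then have "itinerary G \<gamma> R x \<one> = ?z \<one>" unfolding restrict_eq_iff by blast
      then show ?thesis by (simp add: itinerary_one[OF \<gamma>])
    qed
    then have "R = (\<lambda>_. 0)" by blast
    then show "itineraries G \<gamma> R = {?z}" using it by simp
  qed
  then have "isolated_system G {?z}"
    unfolding isolated_system_def using assms(1) it[of \<alpha>]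
    by (intro conjI exI[of _ "{\<one>}"] exI[of _ \<alpha>] exI[of _ "\<lambda>_. 0"]) auto
  then show ?thesis by (simp add: same_isolated_def it)
qed

text \<open>Each stage refines twice, once from either side, whence the double \<open>base_label\<close>.\<close>

lemma back_and_forth:
  assumes \<alpha>: "generic G \<alpha>" and \<beta>: "generic G \<beta>"
  obtains P Q where "\<And>n. same_isolated G \<alpha> \<beta> (P n) (Q n)"
    "\<And>n x. base_label (base_label (P (Suc n) x)) = P n x"
    "\<And>n x. base_label (base_label (Q (Suc n) x)) = Q n x"
    "\<And>n. reads_bit n (P (Suc n))" "\<And>n. reads_bit n (Q (Suc n))"
proof -
  define step where "step n p q \<longleftrightarrow>
      (\<forall>x. base_label (base_label (fst q x)) = fst p x) \<and>
      (\<forall>x. base_label (base_label (snd q x)) = snd p x) \<and>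
      reads_bit n (fst q) \<and> reads_bit n (snd q)"
    for n and p q :: "((nat \<Rightarrow> bool) \<Rightarrow> nat) \<times> ((nat \<Rightarrow> bool) \<Rightarrow> nat)"
  have "\<exists>f. \<forall>n. same_isolated G \<alpha> \<beta> (fst (f n)) (snd (f n)) \<and> step n (f n) (f (Suc n))"
  proof (rule dependent_nat_choice)
    show "\<exists>p. same_isolated G \<alpha> \<beta> (fst p) (snd p)"
      using same_isolated_const[of \<alpha> \<beta>] \<alpha> \<beta> unfolding generic_def
      by (intro exI[of _ "(\<lambda>_. 0, \<lambda>_. 0)"]) simp
    fix p n assume p: "same_isolated G \<alpha> \<beta> (fst p) (snd p)"
    obtain R S where RS: "same_isolated G \<alpha> \<beta> R S" "\<And>x. base_label (R x) = fst p x"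
      "\<And>x. base_label (S x) = snd p x" "reads_bit n R"
      using same_isolated_step[OF \<alpha> \<beta> p, of n] by (elim exE conjE) blast
    obtain S' R' where RS': "same_isolated G \<beta> \<alpha> S' R'" "\<And>x. base_label (S' x) = S x"
      "\<And>x. base_label (R' x) = R x" "reads_bit n S'"
      using same_isolated_step[OF \<beta> \<alpha> same_isolated_sym[OF RS(1)], of n] by (elim exE conjE) blast
    have "reads_bit n R'"
    proof -
      obtain h where "\<forall>x. h (R x) = x n" using RS(4) unfolding reads_bit_def by (rule exE)
      then show ?thesis
        unfolding reads_bit_def by (intro exI[of _ "\<lambda>k. h (base_label k)"]) (simp add: RS'(3))
    qed
    then have "step n p (R', S')"
      unfolding step_def fst_conv snd_conv by (intro conjI allI RS'(4)) (simp_all only: RS' RS)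
    then show "\<exists>q. same_isolated G \<alpha> \<beta> (fst q) (snd q) \<and> step n p q"
      using same_isolated_sym[OF RS'(1)] by (intro exI[of _ "(R', S')"]) simp
  qed
  then obtain f where f: "\<And>n. same_isolated G \<alpha> \<beta> (fst (f n)) (snd (f n))"
      "\<And>n. step n (f n) (f (Suc n))" by blast
  show ?thesis
    by (rule that[of "\<lambda>n. fst (f n)" "\<lambda>n. snd (f n)"], rule f(1))
      (use f(2) in \<open>unfold step_def, blast+\<close>)
qed

text \<open>For each \<open>n\<close> some point has the same itinerary as \<open>x\<close>. These points form a decreasing sequence of
  non-empty closed sets, as later labels refine earlier ones; a point in the intersection serves
  for all \<open>n\<close>.\<close>

lemma common_itinerary_point:
  assumes \<alpha>: "\<alpha> \<in> actions G" and \<beta>: "\<beta> \<in> actions G"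
    and Q: "\<And>n. locally_constant cantor_space (Q n)"
    and eq: "\<And>n. itineraries G \<alpha> (P n) = itineraries G \<beta> (Q n)"
    and P1: "\<And>n x. d (P (Suc n) x) = P n x" and Q1: "\<And>n x. d (Q (Suc n) x) = Q n x"
  shows "\<exists>y. \<forall>n. itinerary G \<alpha> (P n) x = itinerary G \<beta> (Q n) y"
proof -
  define C where "C n = {y. itinerary G \<alpha> (P n) x = itinerary G \<beta> (Q n) y}" for n
  have "(\<Inter>n. C n) \<noteq> {}"
  proof (rule compact_space_imp_nest[OF compact_space_cantor])
    fix n
    have "closedin cantor_space {y. P n (\<alpha> (inv g) x) = Q n (\<beta> (inv g) y)}" if g: "g \<in> carrier G" for g
    proof -
      have "locally_constant cantor_space (\<lambda>y. Q n (\<beta> (inv g) y))"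
        by (rule locally_constant_compose[OF action_continuous[OF \<beta>] Q]) (simp add: g)
      from closedin_locally_constant_Collect[OF this, of "\<lambda>v. P n (\<alpha> (inv g) x) = v"]
      show ?thesis by simp
    qed
    then have "closedin cantor_space (\<Inter>g\<in>carrier G. {y. P n (\<alpha> (inv g) x) = Q n (\<beta> (inv g) y)})"
      using one_closed by (intro closedin_Inter) blast+
    moreover have "(\<Inter>g\<in>carrier G. {y. P n (\<alpha> (inv g) x) = Q n (\<beta> (inv g) y)}) = C n"
      unfolding C_def itinerary_def restrict_eq_iff by blast
    ultimately show "closedin cantor_space (C n)" by simp
    have "itinerary G \<alpha> (P n) x \<in> itineraries G \<beta> (Q n)" unfolding eq[symmetric] by (rule rangeI)
    then show "C n \<noteq> {}" unfolding C_def by blast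
  next
    have "C (Suc n) \<subseteq> C n" for n
    proof
      fix y assume "y \<in> C (Suc n)"
      then have "recode G d (itinerary G \<alpha> (P (Suc n)) x) = recode G d (itinerary G \<beta> (Q (Suc n)) y)"
        unfolding C_def by simp
      then show "y \<in> C n"
        unfolding C_def itinerary_comp[symmetric] P1 Q1 by simp
    qed
    then show "decseq C" by (rule decseq_SucI)
  qed
  then show ?thesis unfolding C_def by blast
qed

lemma bits_determined:
  assumes "\<And>n. reads_bit n (P (Suc n))" "\<And>n. P n x = P n y"
  shows "x = y"
proof
  fix n
  obtain h where h: "\<forall>x. h (P (Suc n) x) = x n" using assms(1)[of n] unfolding reads_bit_def by (rule exE)
  have "h (P (Suc n) x) = h (P (Suc n) y)" unfolding assms(2) by (rule refl)
  then show "x n = y n" using h by simp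
qed

text \<open>The relation \<open>E\<close> of having equal itineraries under all labels of the back-and-forth sequence is
  the graph of a bijection. It is invariant under the two actions since itineraries turn actions
  into shifts, and it is continuous since bit \<open>n\<close> of \<open>y\<close> is a function of the label \<open>Q (Suc n) y\<close>,
  which equals \<open>P (Suc n) x\<close>.\<close>

lemma generic_conjugate:
  assumes g\<alpha>: "generic G \<alpha>" and g\<beta>: "generic G \<beta>"
  shows "\<beta> \<in> conjugacy_class G \<alpha>"
proof -
  have \<alpha>: "\<alpha> \<in> actions G" and \<beta>: "\<beta> \<in> actions G" using g\<alpha> g\<beta> by (simp_all add: generic_def)
  obtain P Q where PQ: "\<And>n. same_isolated G \<alpha> \<beta> (P n) (Q n)"
    and P1: "\<And>n x. base_label (base_label (P (Suc n) x)) = P n x"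
    and Q1: "\<And>n x. base_label (base_label (Q (Suc n) x)) = Q n x"
    and Ph: "\<And>n. reads_bit n (P (Suc n))" and Qh: "\<And>n. reads_bit n (Q (Suc n))"
    using back_and_forth[OF g\<alpha> g\<beta>] by blast
  have P: "locally_constant cantor_space (P n)" and Q: "locally_constant cantor_space (Q n)"
    and eq: "itineraries G \<alpha> (P n) = itineraries G \<beta> (Q n)" for n
    using PQ[of n] unfolding same_isolated_def by - (elim conjE, assumption)+
  define E where "E x y \<longleftrightarrow> (\<forall>n. itinerary G \<alpha> (P n) x = itinerary G \<beta> (Q n) y)" for x y
  have ex1: "\<exists>y. E x y" for x
    unfolding E_def by (rule common_itinerary_point[OF \<alpha> \<beta> Q eq, of "\<lambda>k. base_label (base_label k)"])
      (rule P1, rule Q1)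
  have ex2: "\<exists>x. E x y" for y
  proof -
    have "\<exists>x. \<forall>n. itinerary G \<beta> (Q n) y = itinerary G \<alpha> (P n) x"
      by (rule common_itinerary_point[OF \<beta> \<alpha> P eq[symmetric], of "\<lambda>k. base_label (base_label k)"])
        (rule Q1, rule P1)
    then show ?thesis unfolding E_def by metis
  qed
  have E0: "P n x = Q n y" if "E x y" for n x y
  proof -
    have "itinerary G \<alpha> (P n) x = itinerary G \<beta> (Q n) y" using that unfolding E_def by (rule spec)
    then have "itinerary G \<alpha> (P n) x \<one> = itinerary G \<beta> (Q n) y \<one>" by (rule fun_cong)
    then show ?thesis unfolding itinerary_one[OF \<alpha>] itinerary_one[OF \<beta>] .
  qed
  have uniq2: "y = z" if y: "E x y" and z: "E x z" for x y z
    by (rule bits_determined[of Q, OF Qh]) (use E0[OF y] E0[OF z] in metis)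
  have uniq1: "x = z" if x: "E x y" and z: "E z y" for x y z
    by (rule bits_determined[of P, OF Ph]) (use E0[OF x] E0[OF z] in metis)
  obtain \<phi> where \<phi>: "\<And>x. E x (\<phi> x)" using ex1 by metis
  have bij: "bij \<phi>"
  proof (rule bijI)
    show "inj \<phi>"
    proof (rule injI)
      fix x y assume eq: "\<phi> x = \<phi> y"
      have "E y (\<phi> x)" unfolding eq by (rule \<phi>)
      with \<phi>[of x] show "x = y" by (rule uniq1)
    qed
    show "surj \<phi>"
      unfolding surj_def
    proof
      fix y
      obtain x where "E x y" using ex2 by (rule exE)
      then have "y = \<phi> x" using \<phi> by (rule uniq2)
      then show "\<exists>x. y = \<phi> x" by blast
    qed
  qed
  have cont: "continuous_map cantor_space cantor_space \<phi>"
    unfolding continuous_map_cantor_iff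
  proof
    fix n
    obtain h where h: "\<forall>x. h (Q (Suc n) x) = x n" using Qh[of n] unfolding reads_bit_def by (rule exE)
    have "\<phi> x n = h (P (Suc n) x)" for x
      unfolding E0[OF \<phi>] by (rule h[THEN spec, symmetric])
    then show "locally_constant cantor_space (\<lambda>x. \<phi> x n)"
      using locally_constant_comp[OF P[of "Suc n"], of h] by presburger
  qed
  have hom: "\<phi> \<in> carrier homeo_group"
    unfolding carrier_homeo_group
    by (rule continuous_imp_homeomorphic_map[OF cont compact_space_cantor Hausdorff_space_cantor])
      (use bij in \<open>simp_all add: bij_is_inj bij_is_surj\<close>)
  have equiv: "\<phi> (\<alpha> g x) = \<beta> g (\<phi> x)" if g: "g \<in> carrier G" for g x
  proof -
    have "E (\<alpha> g x) (\<beta> g (\<phi> x))"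
      unfolding E_def itinerary_shift[OF \<alpha> g] itinerary_shift[OF \<beta> g]
    proof
      fix n
      have "itinerary G \<alpha> (P n) x = itinerary G \<beta> (Q n) (\<phi> x)" using \<phi>[of x] unfolding E_def by (rule spec)
      then show "shift G g (itinerary G \<alpha> (P n) x) = shift G g (itinerary G \<beta> (Q n) (\<phi> x))" by (rule arg_cong)
    qed
    then show ?thesis by (rule uniq2[OF \<phi>])
  qed
  have "\<beta> = conjugate_action G \<phi> \<alpha>"
  proof
    fix g
    show "\<beta> g = conjugate_action G \<phi> \<alpha> g"
    proof (cases "g \<in> carrier G")
      case True
      have "\<beta> g y = (\<phi> \<circ> \<alpha> g \<circ> inv_into UNIV \<phi>) y" for y
        unfolding comp_apply equiv[OF True] by (simp add: surj_f_inv_f[OF bij_is_surj[OF bij]])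
      then have "\<beta> g = \<phi> \<circ> \<alpha> g \<circ> inv_into UNIV \<phi>" by (rule ext)
      then show ?thesis using True by (simp add: conjugate_action_def)
    next
      case False
      then show ?thesis using \<beta> by (simp add: conjugate_action_def actions_def extensional_def)
    qed
  qed
  then show ?thesis using hom unfolding conjugacy_class_def by blast
qed

lemma conjugate_action_in_actions:
  assumes \<alpha>: "\<alpha> \<in> actions G" and \<phi>: "\<phi> \<in> carrier homeo_group"
  shows "conjugate_action G \<phi> \<alpha> \<in> actions G"
proof -
  let ?\<psi> = "inv_into UNIV \<phi>"
  obtain \<psi> where \<psi>: "homeomorphic_maps cantor_space cantor_space \<phi> \<psi>"
    using \<phi> unfolding carrier_homeo_group homeomorphic_map_maps by blast
  then have inv: "\<psi> (\<phi> x) = x" "\<phi> (\<psi> x) = x" for x by (simp_all add: homeomorphic_maps_def)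
  have "?\<psi> = \<psi>" by (rule Hilbert_Choice.inv_equality) (rule inv)+
  then have cont: "continuous_map cantor_space cantor_space ?\<psi>" and inv': "?\<psi> (\<phi> x) = x" "\<phi> (?\<psi> x) = x" for x
    using \<psi> inv by (simp_all add: homeomorphic_maps_def)
  show ?thesis
    unfolding conjugate_action_def
  proof (rule actionsI)
    show "continuous_map cantor_space cantor_space (\<phi> \<circ> \<alpha> g \<circ> ?\<psi>)" if "g \<in> carrier G" for g
      using continuous_map_compose[OF cont continuous_map_compose[OF action_continuous[OF \<alpha> that] homeo_continuous[OF \<phi>]]]
      by (simp add: comp_assoc)
    show "(\<phi> \<circ> \<alpha> \<one> \<circ> ?\<psi>) x = x" for x by (simp add: action_one[OF \<alpha>] inv')
    show "(\<phi> \<circ> \<alpha> (g \<otimes> h) \<circ> ?\<psi>) x = (\<phi> \<circ> \<alpha> g \<circ> ?\<psi>) ((\<phi> \<circ> \<alpha> h \<circ> ?\<psi>) x)"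
      if "g \<in> carrier G" "h \<in> carrier G" for g h x
      using that by (simp add: action_mult[OF \<alpha>] inv')
  qed
qed

lemma openin_actions_nbhdI:
  assumes "V \<subseteq> actions G"
    and "\<And>\<alpha>. \<alpha> \<in> V \<Longrightarrow> \<exists>F (R :: (nat \<Rightarrow> bool) \<Rightarrow> nat). finite F \<and> F \<subseteq> carrier G \<and>
           locally_constant cantor_space R \<and> action_nbhd G \<alpha> F R \<subseteq> V"
  shows "openin (action_topology G) V"
proof (subst openin_subopen, intro ballI)
  fix \<alpha> assume \<alpha>: "\<alpha> \<in> V"
  obtain F and R :: "(nat \<Rightarrow> bool) \<Rightarrow> nat" where F: "finite F" "F \<subseteq> carrier G"
      "locally_constant cantor_space R" "action_nbhd G \<alpha> F R \<subseteq> V"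
    using assms(2)[OF \<alpha>] by (elim exE conjE)
  have "\<alpha> \<in> actions G" using \<alpha> assms(1) by blast
  then obtain U where "openin (action_topology G) U" "\<alpha> \<in> U" "U \<subseteq> action_nbhd G \<alpha> F R"
    using action_nbhd_interior[OF _ F(1-3)] by blast
  then show "\<exists>T. openin (action_topology G) T \<and> \<alpha> \<in> T \<and> T \<subseteq> V" using F(4) by blast
qed

lemma openin_refines_to_isolated: "openin (action_topology G) (refines_to_isolated G P n)"
proof (rule openin_actions_nbhdI)
  show "refines_to_isolated G P n \<subseteq> actions G" unfolding refines_to_isolated_def by (rule Collect_restrict)
  fix \<alpha> assume "\<alpha> \<in> refines_to_isolated G P n"
  then obtain R where \<alpha>: "\<alpha> \<in> actions G" and R: "locally_constant cantor_space R"
     "\<forall>x. base_label (R x) = P x" "reads_bit n R" "isolated_system G (itineraries G \<alpha> R)"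
    unfolding refines_to_isolated_def mem_Collect_eq by (elim exE conjE)
  obtain F where F: "finite F" "F \<subseteq> carrier G"
     "\<forall>\<beta>\<in>action_nbhd G \<alpha> F R. itineraries G \<beta> R = itineraries G \<alpha> R"
    using isolated_system_nbhd[OF \<alpha> R(1) R(4)] by (elim exE conjE)
  have "action_nbhd G \<alpha> F R \<subseteq> refines_to_isolated G P n"
  proof
    fix \<beta> assume \<beta>: "\<beta> \<in> action_nbhd G \<alpha> F R"
    have "isolated_system G (itineraries G \<beta> R)" unfolding F(3)[THEN bspec, OF \<beta>] by (rule R(4))
    moreover have "\<beta> \<in> actions G" using \<beta> by (simp add: action_nbhd_def)
    ultimately show "\<beta> \<in> refines_to_isolated G P n"
      unfolding refines_to_isolated_def mem_Collect_eq
      by (intro conjI exI[of _ R] R)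
  qed
  then show "\<exists>F (R :: (nat \<Rightarrow> bool) \<Rightarrow> nat). finite F \<and> F \<subseteq> carrier G \<and>
           locally_constant cantor_space R \<and> action_nbhd G \<alpha> F R \<subseteq> refines_to_isolated G P n"
    by (intro exI[of _ F] exI[of _ R] conjI F R)
qed

text \<open>If the system of \<open>P\<close> differs from the coarsening of \<open>Z\<close>, it does so on the window determining the
  coarsening, hence also for nearby actions. This is where the coarsening has to be isolated: it
  makes the condition in the definition of \<open>lifts_to\<close> clopen.\<close>

lemma openin_lifts_to:
  assumes P: "locally_constant cantor_space P" and Z: "isolated_system G Z"
    and Y: "isolated_system G (recode G base_label ` Z)"
  shows "openin (action_topology G) (lifts_to G P Z)"
proof (rule openin_actions_nbhdI)
  show "lifts_to G P Z \<subseteq> actions G" unfolding lifts_to_def by (rule Collect_restrict)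
  let ?Y = "recode G base_label ` Z"
  fix \<alpha> assume \<alpha>Z: "\<alpha> \<in> lifts_to G P Z"
  then have \<alpha>: "\<alpha> \<in> actions G" by (simp add: lifts_to_def)
  show "\<exists>F (R :: (nat \<Rightarrow> bool) \<Rightarrow> nat). finite F \<and> F \<subseteq> carrier G \<and>
           locally_constant cantor_space R \<and> action_nbhd G \<alpha> F R \<subseteq> lifts_to G P Z"
  proof (cases "itineraries G \<alpha> P = ?Y")
    case True
    with \<alpha>Z have "\<exists>R. locally_constant cantor_space R \<and> (\<forall>x. base_label (R x) = P x) \<and> itineraries G \<alpha> R = Z"
      unfolding lifts_to_def mem_Collect_eq by (elim conjE) (drule mp)
    then obtain R where R: "locally_constant cantor_space R" "\<forall>x. base_label (R x) = P x"
       "itineraries G \<alpha> R = Z" by (elim exE conjE)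
    obtain F where F: "finite F" "F \<subseteq> carrier G"
       "\<forall>\<beta>\<in>action_nbhd G \<alpha> F R. itineraries G \<beta> R = itineraries G \<alpha> R"
      using isolated_system_nbhd[OF \<alpha> R(1)] Z unfolding R(3) by blast
    have "action_nbhd G \<alpha> F R \<subseteq> lifts_to G P Z"
    proof
      fix \<beta> assume \<beta>: "\<beta> \<in> action_nbhd G \<alpha> F R"
      have "itineraries G \<beta> R = Z" unfolding F(3)[THEN bspec, OF \<beta>] by (rule R(3))
      moreover have "\<beta> \<in> actions G" using \<beta> by (simp add: action_nbhd_def)
      ultimately show "\<beta> \<in> lifts_to G P Z"
        unfolding lifts_to_def mem_Collect_eq by (intro conjI impI exI[of _ R] R)
    qed
    then show ?thesis by (intro exI[of _ F] exI[of _ R] conjI F R)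
  next
    case False
    obtain F where F: "finite F" "F \<subseteq> carrier G" "determined_by_patterns G F ?Y"
      using Y unfolding isolated_system_def by (elim exE conjE)
    have "action_nbhd G \<alpha> (m_inv G ` F) P \<subseteq> lifts_to G P Z"
    proof
      fix \<beta> assume \<beta>: "\<beta> \<in> action_nbhd G \<alpha> (m_inv G ` F) P"
      have "itineraries G \<beta> P \<noteq> ?Y"
      proof
        assume "itineraries G \<beta> P = ?Y"
        then have "patterns F (itineraries G \<alpha> P) = patterns F ?Y"
          using patterns_itineraries_nbhd[OF F(2) \<beta>] by simp
        then have "itineraries G \<alpha> P = ?Y" by (rule determined_by_patternsD[OF F(3) \<alpha> P])
        with False show False by (rule notE)
      qed
      moreover have "\<beta> \<in> actions G" using \<beta> by (simp add: action_nbhd_def)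
      ultimately show "\<beta> \<in> lifts_to G P Z" by (simp add: lifts_to_def)
    qed
    moreover have "finite (m_inv G ` F)" "m_inv G ` F \<subseteq> carrier G" using F(1,2) by auto
    ultimately show ?thesis using P by (intro exI[of _ "m_inv G ` F"] exI[of _ P] conjI)
  qed
qed

end

section \<open>A comeager conjugacy class\<close>

lemma dense_openI:
  assumes "\<And>U x. openin X U \<Longrightarrow> x \<in> U \<Longrightarrow> \<exists>y\<in>U. y \<in> V"
  shows "X closure_of V = topspace X"
  using assms unfolding closure_of_def by blast

lemma comeager_in_contains_Inter:
  assumes cnt: "countable \<O>"
    and opn: "\<And>V. V \<in> \<O> \<Longrightarrow> openin X V" and dns: "\<And>V. V \<in> \<O> \<Longrightarrow> X closure_of V = topspace X"
    and S: "S \<subseteq> topspace X" "topspace X \<inter> \<Inter>\<O> \<subseteq> S"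
  shows "comeager_in X S"
proof -
  let ?\<F> = "(\<lambda>V. (topspace X - S) - V) ` \<O>"
  have "nowhere_dense_in X ((topspace X - S) - V)" if V: "V \<in> \<O>" for V
  proof -
    have "closedin X (topspace X - V)" using opn[OF V] by blast
    then have "X closure_of ((topspace X - S) - V) \<subseteq> topspace X - V"
      by (intro closure_of_minimal) auto
    then have "X interior_of (X closure_of ((topspace X - S) - V)) \<subseteq> X interior_of (topspace X - V)"
      by (rule interior_of_mono)
    also have "\<dots> = {}" by (simp add: interior_of_complement dns[OF V])
    finally show ?thesis by (auto simp: nowhere_dense_in_def)
  qed
  moreover have "topspace X - S = \<Union>?\<F>" using S(2) by blast
  ultimately have "meager_in X (topspace X - S)"
    unfolding meager_in_def using cnt by (intro exI[of _ ?\<F>]) auto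
  then show ?thesis using S(1) by (simp add: comeager_in_def)
qed

theorem mainTheorem4:
  fixes G :: "('g, 'm) monoid_scheme"
  assumes "group G"
    and "countable (carrier G)"
    and "\<And>A :: nat set. finite A \<Longrightarrow> 2 \<le> card A \<Longrightarrow>
           dense_in (subshift_topology G A) (isolated_points (subshift_topology G A))"
  shows "strong_topological_Rokhlin_property G"
proof -
  interpret group G by (rule assms(1))
  define \<L> where "\<L> = {P :: (nat \<Rightarrow> bool) \<Rightarrow> nat. locally_constant cantor_space P}"
  define \<Z> where "\<Z> = {Z. isolated_system G Z}"
  define \<O>1 where "\<O>1 = (\<lambda>(P, n). refines_to_isolated G P n) ` (\<L> \<times> UNIV)"
  define \<O>2 where "\<O>2 = (\<lambda>(P, Z). lifts_to G P Z) ` (\<L> \<times> {Z \<in> \<Z>. recode G base_label ` Z \<in> \<Z>})"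
  have \<L>: "countable \<L>" unfolding \<L>_def by (rule countable_locally_constant_cantor)
  have \<Z>: "countable \<Z>" unfolding \<Z>_def using assms(2) by (rule countable_isolated_systems)
  have "countable {Z \<in> \<Z>. recode G base_label ` Z \<in> \<Z>}" by (rule countable_subset[OF _ \<Z>]) (rule Collect_restrict)
  then have "countable (\<O>1 \<union> \<O>2)"
    unfolding \<O>1_def \<O>2_def using \<L> by (intro countable_Un countable_image countable_SIGMA) auto
  moreover have "openin (action_topology G) V \<and>
      (action_topology G) closure_of V = topspace (action_topology G)" if V: "V \<in> \<O>1 \<union> \<O>2" for V
    using V
  proof
    assume "V \<in> \<O>1"
    then obtain P n where P: "locally_constant cantor_space P" and V: "V = refines_to_isolated G P n"
      unfolding \<O>1_def \<L>_def by auto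
    have "\<exists>\<beta>\<in>U. \<beta> \<in> refines_to_isolated G P n" if U: "openin (action_topology G) U" "\<alpha> \<in> U" for U \<alpha>
    proof -
      have "\<exists>\<beta>\<in>U. \<exists>R. locally_constant cantor_space R \<and> (\<forall>x. base_label (R x) = P x) \<and>
          reads_bit n R \<and> isolated_system G (itineraries G \<beta> R)"
        by (rule dense_isolated_refinement[OF assms(2) _ P U]) (rule assms(3))
      then obtain \<beta> where \<beta>: "\<beta> \<in> U" "\<exists>R. locally_constant cantor_space R \<and>
          (\<forall>x. base_label (R x) = P x) \<and> reads_bit n R \<and> isolated_system G (itineraries G \<beta> R)"
        by (rule bexE)
      have "\<beta> \<in> actions G" using openin_subset[OF U(1)] \<beta>(1) topspace_action_topology by blast
      then have "\<beta> \<in> refines_to_isolated G P n"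
        unfolding refines_to_isolated_def mem_Collect_eq using \<beta>(2) by (rule conjI)
      then show ?thesis using \<beta>(1) by (rule bexI)
    qed
    then show ?thesis unfolding V using openin_refines_to_isolated by (intro conjI dense_openI) auto
  next
    assume "V \<in> \<O>2"
    then obtain P Z where P: "locally_constant cantor_space P" and Z: "isolated_system G Z"
        "isolated_system G (recode G base_label ` Z)" and V: "V = lifts_to G P Z"
      unfolding \<O>2_def \<L>_def \<Z>_def by auto
    have "\<exists>\<beta>\<in>U. \<beta> \<in> lifts_to G P Z" if U: "openin (action_topology G) U" "\<alpha> \<in> U" for U \<alpha>
    proof (cases "itineraries G \<alpha> P = recode G base_label ` Z")
      case True
      obtain \<beta> where \<beta>: "\<beta> \<in> U" "\<exists>R. locally_constant cantor_space R \<and> (\<forall>x. base_label (R x) = P x) \<and>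
           itineraries G \<beta> R = Z"
        using dense_lift[OF assms(2) P Z(1) U True] by (elim bexE)
      have "\<beta> \<in> actions G" using openin_subset[OF U(1)] \<beta>(1) topspace_action_topology by blast
      then have "\<beta> \<in> lifts_to G P Z"
        unfolding lifts_to_def mem_Collect_eq using \<beta>(2) by (intro conjI impI)
      then show ?thesis using \<beta>(1) by (rule bexI)
    next
      case False
      have "\<alpha> \<in> actions G" using openin_subset[OF U(1)] U(2) topspace_action_topology by blast
      then have "\<alpha> \<in> lifts_to G P Z" using False by (simp add: lifts_to_def)
      then show ?thesis using U(2) by (rule bexI)
    qed
    then show ?thesis unfolding V using openin_lifts_to[OF P Z] by (intro conjI dense_openI) auto
  qed
  moreover have "generic G \<alpha>" if \<alpha>: "\<alpha> \<in> topspace (action_topology G) \<inter> \<Inter>(\<O>1 \<union> \<O>2)" for \<alpha>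
    unfolding generic_def
  proof (intro conjI allI impI)
    show "\<alpha> \<in> actions G" using \<alpha> by (simp add: topspace_action_topology)
    fix P :: "(nat \<Rightarrow> bool) \<Rightarrow> nat" assume P: "locally_constant cantor_space P"
    show "\<alpha> \<in> refines_to_isolated G P n" for n
    proof -
      have "refines_to_isolated G P n \<in> \<O>1" unfolding \<O>1_def \<L>_def using P by force
      then show ?thesis using \<alpha> by blast
    qed
    fix Z assume "isolated_system G Z" "isolated_system G (recode G base_label ` Z)"
    then have "lifts_to G P Z \<in> \<O>2" unfolding \<O>2_def \<L>_def \<Z>_def using P by force
    then show "\<alpha> \<in> lifts_to G P Z" using \<alpha> by blast
  qed
  ultimately have comeager: "comeager_in (action_topology G) (conjugacy_class G \<alpha>)"
    if \<alpha>: "\<alpha> \<in> actions G" and sup: "\<And>\<beta>. generic G \<beta> \<Longrightarrow> \<beta> \<in> conjugacy_class G \<alpha>" for \<alpha>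
  proof (intro comeager_in_contains_Inter[of "\<O>1 \<union> \<O>2"])
    show "conjugacy_class G \<alpha> \<subseteq> topspace (action_topology G)"
      unfolding topspace_action_topology conjugacy_class_def
      using conjugate_action_in_actions[OF \<alpha>] by blast
  qed (use sup in blast)+
  show ?thesis
  proof (cases "\<exists>\<alpha>. generic G \<alpha>")
    case True
    then obtain \<alpha> where \<alpha>: "generic G \<alpha>" by (rule exE)
    then have "\<alpha> \<in> actions G" by (simp add: generic_def)
    moreover have "comeager_in (action_topology G) (conjugacy_class G \<alpha>)"
      using calculation generic_conjugate[OF \<alpha>] by (rule comeager)
    ultimately show ?thesis unfolding strong_topological_Rokhlin_property_def by blast
  next
    case False
    \<comment> \<open>Without generic actions the whole space is meager, so every conjugacy class is comeager.\<close>
    have "restrict (\<lambda>g x. x) (carrier G) \<in> actions G"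
      by (rule actionsI) (simp_all add: continuous_map_id[unfolded id_def])
    moreover have "comeager_in (action_topology G) (conjugacy_class G (restrict (\<lambda>g x. x) (carrier G)))"
      using calculation by (rule comeager) (use False in blast)
    ultimately show ?thesis unfolding strong_topological_Rokhlin_property_def by blast
  qed
qed

end
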